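(* Let $G$ be a $d$-dimensional compact connected Lie group of rank $r$, with Lie algebra $\mathfrak g$ equipped with an $\operatorname{Ad}(G)$-invariant inner product, and let $\operatorname{Ad}\colon G\to\mathrm{SO}(\mathfrak g)\cong\mathrm{SO}(d)$ be the adjoint map. Then $\operatorname{Ad}$ is homotopic, as a map of spaces, to a map with values in $\mathrm{SO}(d-r+1)\subset\mathrm{SO}(d)$. Equivalently, $\operatorname{Ad}$ is $(r-1)$-compressible.
   Context: The rank of $G$ is the dimension of a maximal torus. The adjoint map lands in $\mathrm{SO}(\mathfrak g)$ because $G$ is connected, and $\mathrm{SO}(\mathfrak g)\cong\mathrm{SO}(d)$ is given by a choice of orthonormal basis of $\mathfrak g$. The standard subgroup $\mathrm{SO}(N-q)\subset\mathrm{SO}(N)$ is the subgroup fixing the standard basis vectors $e_1,\dots,e_q$ pointwise. A continuous map $a\colon X\to\mathrm{SO}(N)$ is called $q$-compressible if it is homotopic to a map whose image lies in the standard subgroup $\mathrm{SO}(N-q)\subset\mathrm{SO}(N)$. The homotopy is one of continuous maps; the intermediate and terminal maps need not be homomorphisms. *)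

theory Defs
  imports "HOL-Analysis.Analysis" "HOL-Algebra.Product_Groups"
begin

section \<open>Smooth manifolds\<close>

text \<open>All sets to which these two predicates are applied below are open.\<close>

primrec Ck_on ::
  "nat \<Rightarrow> 'a::real_normed_vector set \<Rightarrow> ('a \<Rightarrow> 'b::real_normed_vector) \<Rightarrow> bool" where
  "Ck_on 0 S f \<longleftrightarrow> continuous_on S f"
| "Ck_on (Suc k) S f \<longleftrightarrow>
     (\<forall>x\<in>S. f differentiable (at x)) \<and> (\<forall>v. Ck_on k S (\<lambda>x. frechet_derivative f (at x) v))"

definition smooth_on ::
  "'a::real_normed_vector set \<Rightarrow> ('a \<Rightarrow> 'b::real_normed_vector) \<Rightarrow> bool" where
  "smooth_on S f \<longleftrightarrow> (\<forall>k. Ck_on k S f)"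

text \<open>A chart is a pair of its domain and a coordinate map; the values of the coordinate map
  outside the domain are irrelevant.\<close>

type_synonym ('g, 'e) chart = "'g set \<times> ('g \<Rightarrow> 'e)"

text \<open>The coordinate expression of \<open>F\<close> with respect to a chart \<open>c\<close> of the source and a chart
  \<open>c'\<close> of the target; for \<open>F = id\<close> this is the coordinate change.\<close>

definition in_charts ::
  "('g, 'e) chart \<Rightarrow> ('h, 'f) chart \<Rightarrow> ('g \<Rightarrow> 'h) \<Rightarrow> 'e \<Rightarrow> 'f" where
  "in_charts c c' F = snd c' \<circ> F \<circ> inv_into (fst c) (snd c)"

definition smooth_chart ::
  "'g topology \<Rightarrow> ('g, 'e::euclidean_space) chart set \<Rightarrow> ('g, 'e) chart \<Rightarrow> bool" where
  "smooth_chart X A c \<longleftrightarrow>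
     openin X (fst c) \<and> open (snd c ` fst c) \<and>
     homeomorphic_map (subtopology X (fst c)) (top_of_set (snd c ` fst c)) (snd c) \<and>
     (\<forall>c'\<in>A. smooth_on (snd c ` (fst c \<inter> fst c')) (in_charts c c' id) \<and>
             smooth_on (snd c' ` (fst c \<inter> fst c')) (in_charts c' c id))"

definition smooth_manifold ::
  "'g topology \<Rightarrow> ('g, 'e::euclidean_space) chart set \<Rightarrow> bool" where
  "smooth_manifold X A \<longleftrightarrow>
     Hausdorff_space X \<and> second_countable X \<and>
     (\<Union>c\<in>A. fst c) = topspace X \<and> (\<forall>c\<in>A. smooth_chart X A c)"

definition smooth_map ::
  "'g topology \<Rightarrow> ('g, 'e::euclidean_space) chart set \<Rightarrow>
   'h topology \<Rightarrow> ('h, 'f::euclidean_space) chart set \<Rightarrow> ('g \<Rightarrow> 'h) \<Rightarrow> bool" where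
  "smooth_map X A Y B F \<longleftrightarrow>
     continuous_map X Y F \<and>
     (\<forall>c\<in>A. \<forall>c'\<in>B. smooth_on (snd c ` {x \<in> fst c. F x \<in> fst c'}) (in_charts c c' F))"

definition prod_atlas ::
  "('g, 'e) chart set \<Rightarrow> ('h, 'f) chart set \<Rightarrow> ('g \<times> 'h, 'e \<times> 'f) chart set" where
  "prod_atlas A B = (\<lambda>(c, c'). (fst c \<times> fst c', map_prod (snd c) (snd c'))) ` (A \<times> B)"

definition embedded_submanifold ::
  "'g topology \<Rightarrow> ('g, 'e::euclidean_space) chart set \<Rightarrow> nat \<Rightarrow> 'g set \<Rightarrow> bool" where
  "embedded_submanifold X A k S \<longleftrightarrow>
     S \<subseteq> topspace X \<and>
     (\<forall>p\<in>S. \<exists>c W. smooth_chart X A c \<and> p \<in> fst c \<and> subspace W \<and> dim W = k \<and>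
                  snd c ` (fst c \<inter> S) = snd c ` fst c \<inter> W)"


section \<open>Tangent spaces\<close>

definition charts_at :: "('g, 'e) chart set \<Rightarrow> 'g \<Rightarrow> ('g, 'e) chart set" where
  "charts_at A p = {c \<in> A. p \<in> fst c}"

text \<open>A tangent vector at \<open>p\<close> is the family of its coordinate vectors in all charts of the atlas
  around \<open>p\<close>, subject to the transformation law under coordinate changes (and \<open>0\<close> at all other
  pairs, so that equality of tangent vectors is equality of functions). The vector space
  operations are pointwise.\<close>

definition tangent_space ::
  "('g, 'e::euclidean_space) chart set \<Rightarrow> 'g \<Rightarrow> (('g, 'e) chart \<Rightarrow> 'e) set" where
  "tangent_space A p = {v.
     (\<forall>c. c \<notin> charts_at A p \<longrightarrow> v c = 0) \<and>
     (\<forall>c\<in>charts_at A p. \<forall>c'\<in>charts_at A p.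
        v c' = frechet_derivative (in_charts c c' id) (at (snd c p)) (v c))}"

text \<open>By the chain rule the result does not depend on the chosen chart of the source.\<close>

definition tangent_map ::
  "('g, 'e::euclidean_space) chart set \<Rightarrow> 'g \<Rightarrow> ('h, 'f::euclidean_space) chart set \<Rightarrow>
   ('g \<Rightarrow> 'h) \<Rightarrow> (('g, 'e) chart \<Rightarrow> 'e) \<Rightarrow> ('h, 'f) chart \<Rightarrow> 'f" where
  "tangent_map A p B F v =
     (\<lambda>c'. if c' \<in> charts_at B (F p)
           then let c = SOME c. c \<in> charts_at A p
                in frechet_derivative (in_charts c c' F) (at (snd c p)) (v c)
           else 0)"


section \<open>Lie groups\<close>

definition lie_group ::
  "'g monoid \<Rightarrow> 'g topology \<Rightarrow> ('g, 'e::euclidean_space) chart set \<Rightarrow> bool" where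
  "lie_group G X A \<longleftrightarrow>
     group G \<and> topspace X = carrier G \<and> smooth_manifold X A \<and>
     smooth_map (prod_topology X X) (prod_atlas A A) X A (\<lambda>(x, y). x \<otimes>\<^bsub>G\<^esub> y) \<and>
     smooth_map X A X A (\<lambda>x. inv\<^bsub>G\<^esub> x)"

text \<open>Only the vector space underlying the Lie algebra is needed here, not the bracket.\<close>

definition lie_algebra ::
  "'g monoid \<Rightarrow> ('g, 'e::euclidean_space) chart set \<Rightarrow> (('g, 'e) chart \<Rightarrow> 'e) set" where
  "lie_algebra G A = tangent_space A \<one>\<^bsub>G\<^esub>"

definition Ad ::
  "'g monoid \<Rightarrow> ('g, 'e::euclidean_space) chart set \<Rightarrow> 'g \<Rightarrow>
   (('g, 'e) chart \<Rightarrow> 'e) \<Rightarrow> ('g, 'e) chart \<Rightarrow> 'e" where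
  "Ad G A g = tangent_map A \<one>\<^bsub>G\<^esub> A (\<lambda>x. g \<otimes>\<^bsub>G\<^esub> x \<otimes>\<^bsub>G\<^esub> inv\<^bsub>G\<^esub> g)"

definition inner_product_on ::
  "('c \<Rightarrow> 'e::real_vector) set \<Rightarrow> (('c \<Rightarrow> 'e) \<Rightarrow> ('c \<Rightarrow> 'e) \<Rightarrow> real) \<Rightarrow> bool" where
  "inner_product_on V B \<longleftrightarrow>
     (\<forall>u\<in>V. \<forall>v\<in>V. B u v = B v u) \<and>
     (\<forall>u\<in>V. \<forall>v\<in>V. \<forall>w\<in>V. \<forall>s t.
        B (\<lambda>c. s *\<^sub>R u c + t *\<^sub>R v c) w = s * B u w + t * B v w) \<and>
     (\<forall>v\<in>V. v \<noteq> (\<lambda>c. 0) \<longrightarrow> B v v > 0)"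

definition orthonormal_basis_on ::
  "('c \<Rightarrow> 'e::real_vector) set \<Rightarrow> (('c \<Rightarrow> 'e) \<Rightarrow> ('c \<Rightarrow> 'e) \<Rightarrow> real) \<Rightarrow>
   ('n::finite \<Rightarrow> 'c \<Rightarrow> 'e) \<Rightarrow> bool" where
  "orthonormal_basis_on V B b \<longleftrightarrow>
     range b \<subseteq> V \<and>
     (\<forall>i j. B (b i) (b j) = (if i = j then 1 else 0)) \<and>
     (\<forall>v\<in>V. \<exists>s. v = (\<lambda>c. \<Sum>i\<in>UNIV. s i *\<^sub>R b i c))"

definition Ad_invariant ::
  "'g monoid \<Rightarrow> ('g, 'e::euclidean_space) chart set \<Rightarrow>
   ((('g, 'e) chart \<Rightarrow> 'e) \<Rightarrow> (('g, 'e) chart \<Rightarrow> 'e) \<Rightarrow> real) \<Rightarrow> bool" where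
  "Ad_invariant G A B \<longleftrightarrow>
     (\<forall>g\<in>carrier G. \<forall>u\<in>lie_algebra G A. \<forall>v\<in>lie_algebra G A.
        B (Ad G A g u) (Ad G A g v) = B u v)"

text \<open>The matrix of \<open>Ad g\<close> in the orthonormal basis \<open>b\<close>: its \<open>j\<close>-th column consists of the
  coefficients of the image of \<open>b j\<close>.\<close>

definition Ad_matrix ::
  "'g monoid \<Rightarrow> ('g, 'e::euclidean_space) chart set \<Rightarrow>
   ((('g, 'e) chart \<Rightarrow> 'e) \<Rightarrow> (('g, 'e) chart \<Rightarrow> 'e) \<Rightarrow> real) \<Rightarrow>
   ('n::finite \<Rightarrow> ('g, 'e) chart \<Rightarrow> 'e) \<Rightarrow> 'g \<Rightarrow> real ^ 'n ^ 'n" where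
  "Ad_matrix G A B b g = (\<chi> i j. B (b i) (Ad G A g (b j)))"


section \<open>Maximal tori\<close>

definition circle_group :: "complex monoid" where
  "circle_group = \<lparr>carrier = sphere 0 1, monoid.mult = (*), one = 1\<rparr>"

text \<open>A \<open>k\<close>-dimensional torus in a Lie group: a \<open>k\<close>-dimensional embedded Lie subgroup isomorphic to
  the \<open>k\<close>-fold power of the circle group. The isomorphism is only required to be a homeomorphism,
  because a continuous isomorphism of Lie groups is automatically a diffeomorphism.\<close>

definition torus_in ::
  "'g monoid \<Rightarrow> 'g topology \<Rightarrow> ('g, 'e::euclidean_space) chart set \<Rightarrow> nat \<Rightarrow> 'g set \<Rightarrow> bool" where
  "torus_in G X A k T \<longleftrightarrow>
     subgroup T G \<and> embedded_submanifold X A k T \<and>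
     (\<exists>F. F \<in> iso (product_group {..<k} (\<lambda>_. circle_group)) (G\<lparr>carrier := T\<rparr>) \<and>
          homeomorphic_map (product_topology (\<lambda>_. top_of_set (sphere 0 1)) {..<k})
                           (subtopology X T) F)"

definition maximal_torus ::
  "'g monoid \<Rightarrow> 'g topology \<Rightarrow> ('g, 'e::euclidean_space) chart set \<Rightarrow> nat \<Rightarrow> 'g set \<Rightarrow> bool" where
  "maximal_torus G X A k T \<longleftrightarrow>
     torus_in G X A k T \<and> (\<forall>k' T'. torus_in G X A k' T' \<and> T \<subseteq> T' \<longrightarrow> T' = T)"

definition lie_rank ::
  "'g monoid \<Rightarrow> 'g topology \<Rightarrow> ('g, 'e::euclidean_space) chart set \<Rightarrow> nat \<Rightarrow> bool" where
  "lie_rank G X A r \<longleftrightarrow> (\<exists>T. maximal_torus G X A r T)"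


section \<open>Compressibility\<close>

definition SO :: "(real ^ 'n ^ 'n) set" where
  "SO = {M. rotation_matrix M}"

text \<open>With \<open>N = CARD('n)\<close> and the coordinates ordered by the linear order of \<open>'n\<close>, this is the
  standard subgroup \<open>SO(m)\<close> of \<open>SO(N)\<close>, that is, the one fixing the first \<open>N - m\<close> standard basis
  vectors.\<close>

definition standard_SO :: "nat \<Rightarrow> (real ^ 'n::{finite, linorder} ^ 'n::{finite, linorder}) set" where
  "standard_SO m =
     {M \<in> SO. \<forall>i. card {j. j < i} < CARD('n) - m \<longrightarrow> M *v axis i 1 = axis i 1}"

definition homotopic_into_standard_SO ::
  "'x topology \<Rightarrow> nat \<Rightarrow> ('x \<Rightarrow> real ^ 'n::{finite, linorder} ^ 'n::{finite, linorder}) \<Rightarrow> bool" where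
  "homotopic_into_standard_SO X m a \<longleftrightarrow>
     (\<exists>a'. homotopic_with (\<lambda>_. True) X (top_of_set SO) a a' \<and>
           a' ` topspace X \<subseteq> standard_SO m)"

definition compressible ::
  "nat \<Rightarrow> 'x topology \<Rightarrow> ('x \<Rightarrow> real ^ 'n::{finite, linorder} ^ 'n::{finite, linorder}) \<Rightarrow> bool" where
  "compressible q X a \<longleftrightarrow> homotopic_into_standard_SO X (CARD('n) - q) a"

end

theory Submission
  imports Defs
begin

text \<open>
  Let \<open>V\<close> be the Lie algebra of a torus \<open>T\<close> of dimension \<open>r\<close>. As \<open>T\<close> acts trivially on \<open>V\<close>, the restriction
  of \<open>Ad g\<close> to \<open>V\<close> only depends on the coset \<open>g T\<close>. Near the identity the cosets are parametrized by a slice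
  of dimension \<open>d - r\<close>, so by compactness the restrictions to \<open>V\<close> form finitely many differentiable pieces of
  dimension \<open>d - r\<close>. After a rotation of the basis the first \<open>r - 1\<close> basis vectors lie in \<open>V\<close>.
  The columns are then turned one at a time into standard basis vectors: when \<open>k < r - 1\<close> of them are done, the
  next column takes values in the unit sphere of a space of dimension \<open>d - k\<close>. The cone over these values
  is the image of a set of dimension \<open>d - r + 1 < d - k\<close>, hence misses some direction \<open>- p\<close>, and the column
  can be rotated to \<open>p\<close>, and from there to the basis vector, without moving the earlier ones.
\<close>

section \<open>Rotations\<close>

text \<open>The count that fixes r - 1: after k columns the forbidden directions lie in a set of
  dimension at most (d - r) + 1 + k, which is below d exactly for k < r - 1; one column more and the
  set could fill the space. The obstacle is that turning a column also alters the other ones. They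
  are then no longer columns of \<open>Ad\<close>, and the argument on cosets cannot be repeated. It
  need not be: the turning matrix is a function of the column being turned, so points at which all
  columns under consideration agreed keep this property, and differentiability on the pieces
  persists. Avoiding a direction fails for maps that are merely continuous, as these may raise
  dimension; hence the effort to derive differentiability of \<open>Ad\<close> from the smoothness
  of the multiplication. The slice comes from a product map whose derivative at the base point is
  the identity. An open mapping theorem that asks for the derivative at this point only takes the
  place of the exponential map.\<close>

definition reflection :: "real ^ 'n \<Rightarrow> real ^ 'n ^ 'n" where
  "reflection w = (\<chi> i j. (if i = j then 1 else 0) - 2 * w $ i * w $ j / (w \<bullet> w))"

lemma reflection_mult: "reflection w *v x = x - (2 * (w \<bullet> x) / (w \<bullet> w)) *\<^sub>R w"
proof -
  have "(reflection w *v x) $ i = (x - (2 * (w \<bullet> x) / (w \<bullet> w)) *\<^sub>R w) $ i" for i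
  proof -
    have "(reflection w *v x) $ i
        = (\<Sum>j\<in>UNIV. (if i = j then x $ j else 0) - 2 * w $ i * w $ j / (w \<bullet> w) * x $ j)"
      unfolding reflection_def matrix_vector_mult_def by (auto simp: algebra_simps intro!: sum.cong)
    also have "\<dots> = x $ i - (2 * (w \<bullet> x) / (w \<bullet> w)) * w $ i"
      by (simp add: sum_subtractf inner_vec_def sum_distrib_left sum_distrib_right sum_divide_distrib algebra_simps)
    finally show ?thesis by simp
  qed
  then show ?thesis by (simp add: vec_eq_iff)
qed

lemma transpose_reflection: "transpose (reflection w) = reflection w"
  by (simp add: transpose_def reflection_def vec_eq_iff algebra_simps)

text \<open>Division by zero makes \<open>reflection 0\<close> the identity, so the degenerate axis
  is covered as well.\<close>

lemma reflection_reflection: "reflection w ** reflection w = mat 1"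
  by (cases "w = 0") (simp_all add: matrix_eq reflection_mult matrix_vector_mul_assoc[symmetric]
      inner_diff_right field_simps)

lemma orthogonal_matrix_reflection: "orthogonal_matrix (reflection w)"
  by (simp add: orthogonal_matrix transpose_reflection reflection_reflection)

lemma continuous_on_reflection [continuous_intros]:
  assumes "continuous_on S f" "\<And>x. x \<in> S \<Longrightarrow> f x \<noteq> 0"
  shows "continuous_on S (\<lambda>x. reflection (f x))"
  unfolding reflection_def using assms by (intro continuous_intros) auto

section \<open>Continuity of matrix operations and of the determinant\<close>

lemma continuous_on_matrix_mult [continuous_intros]:
  fixes f :: "_ \<Rightarrow> real ^ 'n ^ 'm" and g :: "_ \<Rightarrow> real ^ 'k ^ 'n"
  assumes "continuous_on S f" "continuous_on S g"
  shows "continuous_on S (\<lambda>x. f x ** g x)"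
  unfolding matrix_matrix_mult_def using assms by (intro continuous_intros) auto

lemma continuous_on_matrix_vector_mult [continuous_intros]:
  fixes f :: "_ \<Rightarrow> real ^ 'n ^ 'm"
  assumes "continuous_on S f" "continuous_on S g"
  shows "continuous_on S (\<lambda>x. f x *v g x)"
  unfolding matrix_vector_mult_def using assms by (intro continuous_intros) auto

lemma continuous_on_det [continuous_intros]:
  fixes f :: "_ \<Rightarrow> real ^ 'n ^ 'n"
  assumes "continuous_on S f"
  shows "continuous_on S (\<lambda>x. det (f x))"
  unfolding det_def using assms by (intro continuous_intros) auto

text \<open>The determinant is continuous with values in {1, -1}, hence constant on a connected
  space. This serves both for the path of turns, which starts at the identity matrix, and for
  \<open>Ad\<close>, which is the identity at \<one>.\<close>

lemma SO_if_connected: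
  fixes a :: "'x \<Rightarrow> real ^ 'n ^ 'n"
  assumes X: "connected_space X" and a: "continuous_map X euclidean a"
    and orth: "\<And>x. x \<in> topspace X \<Longrightarrow> orthogonal_matrix (a x)"
    and x0: "x0 \<in> topspace X" "det (a x0) = 1" and x: "x \<in> topspace X"
  shows "a x \<in> SO"
proof -
  have det: "det (a y) = 1 \<or> det (a y) = -1" if "y \<in> topspace X" for y
    using det_orthogonal_matrix orth that by blast
  have "continuous_on UNIV (det :: real ^ 'n ^ 'n \<Rightarrow> real)"
    by (intro continuous_intros)
  then have "continuous_map X euclidean (det \<circ> a)"
    using a by (intro continuous_map_compose) auto
  then have "connectedin euclidean ((det \<circ> a) ` topspace X)"
    by (rule connectedin_continuous_map_image) (simp add: X connectedin_topspace)
  then have "connected ((det \<circ> a) ` topspace X)"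
    by simp
  moreover have "(det \<circ> a) ` topspace X \<subseteq> {1, -1}"
    using det by auto
  ultimately have "finite ((det \<circ> a) ` topspace X)" "connected ((det \<circ> a) ` topspace X)"
    using finite_subset by auto
  then obtain c where "(det \<circ> a) ` topspace X \<subseteq> {c}"
    by (metis connected_finite_iff_sing empty_subsetI order_refl)
  then have "det (a x) = 1"
    using x0 x by (auto simp: image_subset_iff)
  then show ?thesis
    using orth x by (simp add: SO_def rotation_matrix_def)
qed

text \<open>The second reflection has the axis \<open>u + ((1 - s) u + s v)\<close>. For \<open>s = 0\<close> the two reflections
  cancel; for \<open>s = 1\<close> and unit vectors, the second one exchanges \<open>- u\<close> and \<open>v\<close>.\<close>

definition turn :: "real ^ 'n \<Rightarrow> real ^ 'n \<Rightarrow> real \<Rightarrow> real ^ 'n ^ 'n" where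
  "turn u v s = reflection ((2 - s) *\<^sub>R u + s *\<^sub>R v) ** reflection u"

text \<open>The summands have norms 2 - s and s. On [0, 1] these agree only for s = 1, and
  cancellation there would make the vectors antipodal.\<close>

lemma turn_axis_nonzero:
  fixes u v :: "real ^ 'n"
  assumes "norm u = 1" "norm v = 1" "u \<noteq> - v" "s \<in> {0..1}"
  shows "(2 - s) *\<^sub>R u + s *\<^sub>R v \<noteq> 0"
proof
  assume 0: "(2 - s) *\<^sub>R u + s *\<^sub>R v = 0"
  then have "(2 - s) *\<^sub>R u = - (s *\<^sub>R v)"
    by (simp add: eq_neg_iff_add_eq_0)
  then have "norm ((2 - s) *\<^sub>R u) = norm (s *\<^sub>R v)" by simp
  then have "s = 1" using assms by auto
  then show False using 0 assms by (simp add: eq_neg_iff_add_eq_0)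
qed

lemma turn_0: "norm u = 1 \<Longrightarrow> turn u v 0 = mat 1"
  by (auto simp: turn_def matrix_eq reflection_mult matrix_vector_mul_assoc[symmetric]
      inner_diff_right field_simps power2_norm_eq_inner[symmetric])

lemma turn_SO:
  assumes u: "norm u = 1" and v: "norm v = 1" and "u \<noteq> - v" and s: "s \<in> {0..1}"
  shows "turn u v s \<in> SO"
proof -
  have "continuous_on {0..1} (turn u v)"
    unfolding turn_def using assms turn_axis_nonzero by (intro continuous_intros) auto
  then show ?thesis
    using s turn_0[OF u, of v]
    by (intro SO_if_connected[of "top_of_set {0..1}" "turn u v" 0])
      (auto simp: turn_def connected_space_subtopology intro: orthogonal_matrix_mul orthogonal_matrix_reflection)
qed

lemma turn_1:
  assumes "norm u = 1" "norm v = 1" "u \<noteq> - v"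
  shows "turn u v 1 *v u = v"
proof -
  have "(u + v) \<bullet> (u + v) \<noteq> 0"
    using assms by (simp add: eq_neg_iff_add_eq_0)
  \<comment> \<open>For unit vectors both sides are 2 + 2 (u \<bullet> v), so the reflection
    subtracts exactly one copy of its axis, up to sign.\<close>
  moreover have "(u + v) \<bullet> (u + v) = 2 * ((u + v) \<bullet> u)"
    using assms by (simp add: algebra_simps inner_commute norm_eq_1)
  ultimately have "2 * ((u + v) \<bullet> u) / ((u + v) \<bullet> (u + v)) = 1"
    by simp
  then have "reflection (u + v) *v (- u) = - u + 1 *\<^sub>R (u + v)"
    by (simp only: reflection_mult inner_minus_right mult_minus_right minus_divide_left[symmetric]
        scaleR_minus_left diff_minus_eq_add)
  moreover have "reflection u *v u = - u"
    using assms by (simp add: reflection_mult scaleR_2 norm_eq_1)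
  ultimately show ?thesis
    by (simp add: turn_def scaleR_one add.commute flip: matrix_vector_mul_assoc)
qed

text \<open>Both axes lie in the span of \<open>u\<close> and \<open>v\<close>. This is what
  protects the columns that are already standard basis vectors.\<close>

lemma turn_fixes: "u \<bullet> x = 0 \<Longrightarrow> v \<bullet> x = 0 \<Longrightarrow> turn u v s *v x = x"
  by (simp add: turn_def matrix_vector_mul_assoc[symmetric] reflection_mult inner_add_left)

lemma SO_mult: "M \<in> SO \<Longrightarrow> N \<in> SO \<Longrightarrow> M ** N \<in> SO"
  by (simp add: SO_def rotation_matrix_def orthogonal_matrix_mul det_mul)

lemma orthogonal_matrix_inner:
  fixes M :: "real ^ 'n ^ 'n"
  assumes "orthogonal_matrix M"
  shows "(M *v x) \<bullet> (M *v y) = x \<bullet> y"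
proof -
  have "(M *v x) \<bullet> (M *v y) = ((M *v x) v* M) \<bullet> y"
    by (simp add: dot_lmul_matrix)
  also have "(M *v x) v* M = transpose M ** M *v x"
    by (simp add: matrix_vector_mul_assoc flip: transpose_matrix_vector)
  finally show ?thesis
    using assms by (simp add: orthogonal_matrix)
qed

lemma SO_inner: "M \<in> SO \<Longrightarrow> (M *v x) \<bullet> (M *v y) = x \<bullet> y"
  by (simp add: SO_def rotation_matrix_def orthogonal_matrix_inner)

lemma SO_norm: "M \<in> SO \<Longrightarrow> norm (M *v x) = norm x"
  by (simp add: norm_eq_sqrt_inner SO_inner)

section \<open>Homotopies of matrices made of turns\<close>

text \<open>The homotopy lives on the matrices themselves; composing it with a map whose column
  \<open>k\<close> never equals \<open>- p\<close> deforms that map. Where the column equals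
  \<open>- p\<close>, the axis of the turn would vanish at s = 1.\<close>

lemma homotopic_turn:
  fixes p :: "real ^ 'n"
  assumes p: "norm p = 1"
  shows "homotopic_with (\<lambda>_. True) (top_of_set {M \<in> SO. M *v axis k 1 \<noteq> - p}) (top_of_set SO)
           (\<lambda>M. M) (\<lambda>M. turn (M *v axis k 1) p 1 ** M)"
proof (rule homotopic_with_eq[where f = "\<lambda>M. turn (M *v axis k 1) p 0 ** M"])
  define S :: "(real ^ 'n ^ 'n) set" where "S = {M \<in> SO. M *v axis k 1 \<noteq> - p}"
  have n: "norm (M *v axis k 1) = 1" if "M \<in> SO" for M :: "real ^ 'n ^ 'n"
    using that by (simp add: SO_norm)
  have nz: "(2 - s) *\<^sub>R (M *v axis k 1) + s *\<^sub>R p \<noteq> 0" "M *v axis k 1 \<noteq> 0" if "M \<in> S" "s \<in> {0..1}" for M s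
    using that n turn_axis_nonzero[of "M *v axis k 1" p s] p unfolding S_def by fastforce+
  have "continuous_on ({0..1} \<times> S) (\<lambda>(s, M). turn (M *v axis k 1) p s ** M)"
    unfolding turn_def case_prod_unfold using nz
    by (intro continuous_intros) auto
  moreover have "(\<lambda>(s, M). turn (M *v axis k 1) p s ** M) \<in> ({0..1} \<times> S) \<rightarrow> SO"
    using n p by (auto intro!: SO_mult turn_SO simp: S_def)
  ultimately show "homotopic_with (\<lambda>_. True) (top_of_set {M \<in> SO. M *v axis k 1 \<noteq> - p}) (top_of_set SO)
     (\<lambda>M. turn (M *v axis k 1) p 0 ** M) (\<lambda>M. turn (M *v axis k 1) p 1 ** M)"
    unfolding homotopic_with_def S_def[symmetric]
    by (intro exI[of _ "\<lambda>(s, M). turn (M *v axis k 1) p s ** M"]) (auto simp flip: subtopology_Times)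
qed (auto simp: turn_0 SO_norm)

lemma homotopic_turn_left:
  fixes u v :: "real ^ 'n"
  assumes "norm u = 1" "norm v = 1" "u \<noteq> - v"
  shows "homotopic_with (\<lambda>_. True) (top_of_set SO) (top_of_set SO) (\<lambda>M. M) (\<lambda>M. turn u v 1 ** M)"
proof (rule homotopic_with_eq[where f = "\<lambda>M. turn u v 0 ** M"])
  have nz: "(2 - s) *\<^sub>R u + s *\<^sub>R v \<noteq> 0" "u \<noteq> 0" if "s \<in> {0..1}" for s
    using that turn_axis_nonzero assms by auto
  have "continuous_on ({0..1} \<times> SO) (\<lambda>(s, M). turn u v s ** M)"
    unfolding turn_def case_prod_unfold using nz by (intro continuous_intros) auto
  moreover have "(\<lambda>(s, M). turn u v s ** M) \<in> ({0..1} \<times> SO) \<rightarrow> SO"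
    using assms by (auto intro!: SO_mult turn_SO)
  ultimately show "homotopic_with (\<lambda>_. True) (top_of_set SO) (top_of_set SO)
     (\<lambda>M. turn u v 0 ** M) (\<lambda>M. turn u v 1 ** M)"
    unfolding homotopic_with_def 
    by (intro exI[of _ "\<lambda>(s, M). turn u v s ** M"]) (auto simp flip: subtopology_Times)
qed (use assms in \<open>auto simp: turn_0\<close>)

text \<open>Here the turn acts on the source: it changes the vectors to which the matrices are
  applied. The factor \<open>P\<close> lets such changes be accumulated.\<close>

lemma homotopic_turn_right:
  fixes u v :: "real ^ 'n"
  assumes "norm u = 1" "norm v = 1" "u \<noteq> - v" "P \<in> SO"
  shows "homotopic_with (\<lambda>_. True) (top_of_set SO) (top_of_set SO)
           (\<lambda>M. M ** P) (\<lambda>M. M ** (turn u v 1 ** P))"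
proof (rule homotopic_with_eq[where f = "\<lambda>M. M ** (turn u v 0 ** P)"])
  have nz: "(2 - s) *\<^sub>R u + s *\<^sub>R v \<noteq> 0" "u \<noteq> 0" if "s \<in> {0..1}" for s
    using that turn_axis_nonzero assms by auto
  have "continuous_on ({0..1} \<times> SO) (\<lambda>(s, M). M ** (turn u v s ** P))"
    unfolding turn_def case_prod_unfold using nz by (intro continuous_intros) auto
  moreover have "(\<lambda>(s, M). M ** (turn u v s ** P)) \<in> ({0..1} \<times> SO) \<rightarrow> SO"
    using assms by (auto intro!: SO_mult turn_SO)
  ultimately show "homotopic_with (\<lambda>_. True) (top_of_set SO) (top_of_set SO)
     (\<lambda>M. M ** (turn u v 0 ** P)) (\<lambda>M. M ** (turn u v 1 ** P))"
    unfolding homotopic_with_def 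
    by (intro exI[of _ "\<lambda>(s, M). M ** (turn u v s ** P)"]) (auto simp flip: subtopology_Times)
qed (use assms in \<open>auto simp: turn_0\<close>)

section \<open>Compressing columns\<close>

text \<open>An isometric copy of \<open>S\<close> inside the target has too small a dimension and is
  negligible. Composed with a linear left inverse of the isometry, \<open>f\<close> becomes a
  differentiable map between subsets of one space, and such maps preserve negligibility.\<close>

lemma negligible_differentiable_image_subspace:
  fixes f :: "'a::euclidean_space \<Rightarrow> 'b::euclidean_space"
  assumes S: "subspace S" "dim S < DIM('b)" and "D \<subseteq> S" and f: "f differentiable_on D"
  shows "negligible (f ` D)"
proof -
  obtain h :: "'a \<Rightarrow> 'b" where h: "linear h" "\<And>x. x \<in> S \<Longrightarrow> norm (h x) = norm x"
    using isometry_subset_subspace[OF S(1), of "UNIV :: 'b set"] S(2) by auto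
  have "inj_on h S"
  proof (rule inj_onI)
    fix x y assume "x \<in> S" "y \<in> S" "h x = h y"
    then have "norm (h (x - y)) = norm (x - y)"
      by (intro h(2) subspace_diff[OF S(1)])
    then show "x = y" using \<open>h x = h y\<close> by (simp add: linear_diff[OF h(1)])
  qed
  then obtain g where g: "linear g" "\<And>x. x \<in> S \<Longrightarrow> g (h x) = x"
    using linear_inj_on_left_inverse[OF h(1), of S] S(1) by (metis span_eq_iff)
  have gh: "g ` h ` D = D"
    using g(2) \<open>D \<subseteq> S\<close> by (force simp: image_image subset_iff)
  have "dim (h ` D) \<le> dim S"
    by (meson h(1) \<open>D \<subseteq> S\<close> dim_image_le dim_subset le_trans)
  then have "negligible (h ` D)"
    using S(2) by (intro negligible_lowdim) simp
  moreover have "(\<lambda>x. f (g x)) differentiable_on h ` D"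
    using differentiable_on_compose[of g "h ` D" f] linear_imp_differentiable_on[OF g(1)] f gh by simp
  ultimately have "negligible ((\<lambda>x. f (g x)) ` h ` D)"
    by (intro negligible_differentiable_image_negligible[OF order_refl])
  moreover have "f ` D = (\<lambda>x. f (g x)) ` h ` D"
    by (metis gh image_image)
  ultimately show ?thesis by simp
qed

text \<open>The forbidden set is the cone over the values of all \<open>u j\<close>, thickened by
  the span of the axes in \<open>K\<close>. Thanks to the thickening, a vector outside the set can
  be projected orthogonally to these axes and still does not lie in the cone. The set has dimension
  at most 1 + \<open>dim W\<close> + \<open>card K\<close>.\<close>

lemma avoided_direction:
  fixes u :: "'j \<Rightarrow> real ^ 'n \<Rightarrow> real ^ 'n"
  assumes J: "finite J" and W: "subspace W" "D \<subseteq> W"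
    and u: "\<And>j. j \<in> J \<Longrightarrow> u j differentiable_on D"
    and dim: "dim W + card K + 1 < CARD('n)"
  obtains p where "norm p = 1" "\<And>i. i \<in> K \<Longrightarrow> p \<bullet> axis i 1 = 0" "p \<noteq> - axis k 1"
    "\<And>j w. j \<in> J \<Longrightarrow> w \<in> D \<Longrightarrow> u j w \<noteq> - p"
proof -
  define E :: "(real ^ 'n) set" where "E = span ((\<lambda>i. axis i 1) ` K)"
  \<comment> \<open>Staying outside this space ensures that the projected vector is not 0 and not a
    multiple of \<open>axis k 1\<close>, so that \<open>p\<close> can later be turned to this
    axis.\<close>
  define E' :: "(real ^ 'n) set" where "E' = span ((\<lambda>i. axis i 1) ` insert k K)"
  define Z :: "(real \<times> (real ^ 'n) \<times> (real ^ 'n)) set" where "Z = UNIV \<times> W \<times> E"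
  define \<Theta> where "\<Theta> j = (\<lambda>(t :: real, w, y). t *\<^sub>R u j w + y)" for j
  have dimE: "dim E \<le> card K"
    unfolding E_def dim_span by (intro order_trans[OF dim_le_card'] card_image_le) auto
  have "dim E' \<le> card (insert k K)"
    unfolding E'_def dim_span by (intro order_trans[OF dim_le_card'] card_image_le) auto
  also have "\<dots> \<le> card K + 1"
    by (simp add: card_insert_le_m1 card_insert_if)
  finally have "negligible E'"
    using dim by (intro negligible_lowdim) simp
  have Z: "subspace Z" "dim Z = 1 + (dim W + dim E)"
    using W(1) unfolding Z_def E_def by (auto simp: dim_Times subspace_Times subspace_UNIV)
  have "negligible (\<Theta> j ` (UNIV \<times> D \<times> E))" if "j \<in> J" for j
  proof (rule negligible_differentiable_image_subspace[OF Z(1)])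
    show "dim Z < DIM(real ^ 'n)"
      using dim dimE Z(2) by simp
    show "UNIV \<times> D \<times> E \<subseteq> Z"
      using W(2) by (auto simp: Z_def)
    have "u j differentiable_on (fst \<circ> snd) ` ((UNIV :: real set) \<times> D \<times> E)"
      using u[OF that] by (rule differentiable_on_subset) auto
    then have "(\<lambda>z. u j ((fst \<circ> snd) z)) differentiable_on (UNIV :: real set) \<times> D \<times> E"
      by (rule differentiable_on_compose[rotated])
        (auto intro!: linear_imp_differentiable_on linear_compose linear_fst linear_snd)
    then have "(\<lambda>z. u j (fst (snd z))) differentiable_on (UNIV :: real set) \<times> D \<times> E"
      by simp
    then show "\<Theta> j differentiable_on (UNIV \<times> D \<times> E)"
      unfolding \<Theta>_def case_prod_unfold
      by (intro differentiable_on_add differentiable_on_scaleR differentiable_on_compose[of snd _ snd])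
        (auto intro: bounded_linear_imp_differentiable_on bounded_linear_fst bounded_linear_snd)
  qed
  then have "negligible ((\<Union>j\<in>J. \<Theta> j ` (UNIV \<times> D \<times> E)) \<union> E')"
    using J \<open>negligible E'\<close> by (intro negligible_Un negligible_Union) auto
  then have "(\<Union>j\<in>J. \<Theta> j ` (UNIV \<times> D \<times> E)) \<union> E' \<noteq> UNIV"
    using non_negligible_UNIV by metis
  then obtain z where z: "z \<notin> E'" "\<And>j. j \<in> J \<Longrightarrow> z \<notin> \<Theta> j ` (UNIV \<times> D \<times> E)"
    by blast
  obtain y z' where yz: "y \<in> span E" "\<And>e. e \<in> span E \<Longrightarrow> orthogonal z' e" "z = y + z'"
    using orthogonal_subspace_decomp_exists[of E z] by metis
  have "E \<subseteq> E'"
    unfolding E_def E'_def by (intro span_mono) auto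
  have y: "y \<in> E"
    using yz(1) by (simp add: E_def span_span)
  have z'_notin: "z' \<notin> E'"
    using z(1) y \<open>E \<subseteq> E'\<close> unfolding yz(3) E'_def by (meson span_add subsetD)
  then have "z' \<noteq> 0"
    by (auto simp: E'_def span_zero)
  \<comment> \<open>The sign makes \<open>- p\<close>, the direction to be avoided, point along
    \<open>z'\<close>: a value equal to \<open>- p\<close> would put \<open>z\<close> into the
    forbidden set with parameters \<open>norm z'\<close> and \<open>y\<close>.\<close>
  define p where "p = - (z' /\<^sub>R norm z')"
  have z'p: "z' = norm z' *\<^sub>R (- p)"
    using \<open>z' \<noteq> 0\<close> by (simp add: p_def)
  show thesis
  proof
    show "norm p = 1"
      using \<open>z' \<noteq> 0\<close> by (simp add: p_def)
    show "p \<bullet> axis i 1 = 0" if "i \<in> K" for i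
    proof -
      have "axis i 1 \<in> span E"
        using that unfolding E_def span_span by (intro span_base) auto
      then show ?thesis
        using yz(2) by (simp add: p_def orthogonal_def)
    qed
    show "p \<noteq> - axis k 1"
    proof
      assume "p = - axis k 1"
      then have "z' = norm z' *\<^sub>R axis k 1"
        using z'p by simp
      then have "z' \<in> E'"
        unfolding E'_def by (metis image_insert insertI1 span_base span_scale)
      then show False using z'_notin by simp
    qed
    show "u j w \<noteq> - p" if "j \<in> J" "w \<in> D" for j w
    proof
      assume "u j w = - p"
      then have "z = \<Theta> j (norm z', w, y)"
        using z'p yz(3) by (simp add: \<Theta>_def)
      then show False
        using z(2)[OF that(1)] y that(2) by blast
    qed
  qed
qed

text \<open>The columns in \<open>I\<close> take no other values than on the pieces \<open>\<sigma> j ` D\<close>, which have the dimension of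
  \<open>D\<close>; this bounds the set of directions to be avoided.\<close>

definition pieces_for ::
  "'x set \<Rightarrow> (real ^ 'n) set \<Rightarrow> 'j set \<Rightarrow> ('j \<Rightarrow> real ^ 'n \<Rightarrow> 'x) \<Rightarrow> 'n set \<Rightarrow> ('x \<Rightarrow> real ^ 'n ^ 'n) \<Rightarrow> bool" where
  "pieces_for C D J \<sigma> I a \<longleftrightarrow>
     (\<forall>j\<in>J. \<forall>w\<in>D. \<sigma> j w \<in> C) \<and>
     (\<forall>x\<in>C. \<exists>j\<in>J. \<exists>w\<in>D. \<forall>i\<in>I. a x *v axis i 1 = a (\<sigma> j w) *v axis i 1) \<and>
     (\<forall>j\<in>J. \<forall>i\<in>I. (\<lambda>w. a (\<sigma> j w) *v axis i 1) differentiable_on D)"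

lemma differentiable_on_reflection_mult:
  assumes "f differentiable_on D" "g differentiable_on D" "\<And>w. w \<in> D \<Longrightarrow> f w \<noteq> 0"
  shows "(\<lambda>w. reflection (f w) *v g w) differentiable_on D"
  using assms unfolding reflection_mult differentiable_on_def
  by (auto intro!: differentiable_diff differentiable_scaleR differentiable_divide differentiable_mult differentiable_inner)

section \<open>Turning the columns one after another\<close>

text \<open>The column may well take the value \<open>- axis k 1\<close>, so it cannot be turned to
  \<open>axis k 1\<close> directly. A turn depending on the point brings it to a direction
  \<open>p\<close> whose antipode it misses, and a constant turn brings \<open>p\<close> to the
  axis.\<close>

lemma compress_step:
  fixes a :: "'x \<Rightarrow> real ^ 'n ^ 'n"
  assumes a: "continuous_map X (top_of_set SO) a"
    and J: "finite J" and W: "subspace W" "D \<subseteq> W"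
    and pieces: "pieces_for (topspace X) D J \<sigma> I a"
    and K: "K \<subseteq> I" "k \<in> I" "k \<notin> K"
    and dim: "dim W + card K + 1 < CARD('n)"
    and fixed: "\<And>x i. x \<in> topspace X \<Longrightarrow> i \<in> K \<Longrightarrow> a x *v axis i 1 = axis i 1"
  obtains a' where "homotopic_with (\<lambda>_. True) X (top_of_set SO) a a'"
    "pieces_for (topspace X) D J \<sigma> I a'"
    "\<And>x i. x \<in> topspace X \<Longrightarrow> i \<in> insert k K \<Longrightarrow> a' x *v axis i 1 = axis i 1"
proof -
  define e :: "real ^ 'n" where "e = axis k 1"
  define u where "u x = a x *v e" for x
  obtain p where p: "norm p = 1" "\<And>i. i \<in> K \<Longrightarrow> p \<bullet> axis i 1 = 0" "p \<noteq> - e"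
    and avoid: "\<And>j w. j \<in> J \<Longrightarrow> w \<in> D \<Longrightarrow> u (\<sigma> j w) \<noteq> - p"
    using avoided_direction[OF J W, of "\<lambda>j w. u (\<sigma> j w)" K] pieces K(2) dim
    unfolding pieces_for_def u_def e_def by blast
  have aSO: "a x \<in> SO" if "x \<in> topspace X" for x
    using a that by (auto simp: continuous_map_in_subtopology)
  have e: "norm e = 1" by (simp add: e_def)
  have u: "norm (u x) = 1" if "x \<in> topspace X" for x
    using SO_norm[OF aSO[OF that]] e by (simp add: u_def)
  \<comment> \<open>As \<open>k\<close> is in \<open>I\<close>, every value of this column already
    occurs on one of the pieces.\<close>
  have u_avoid: "u x \<noteq> - p" if x: "x \<in> topspace X" for x
    using pieces that K(2) avoid unfolding pieces_for_def u_def e_def by metis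
  define a1 where "a1 x = turn (u x) p 1 ** a x" for x
  define a' where "a' x = turn p e 1 ** a1 x" for x
  have "continuous_map X (top_of_set {M \<in> SO. M *v axis k 1 \<noteq> - p}) a"
    using a aSO u_avoid by (auto simp: continuous_map_in_subtopology u_def e_def)
  from homotopic_with_compose_continuous_map_right[OF homotopic_turn[OF p(1), of k] this, where q = "\<lambda>_. True"]
  have h1: "homotopic_with (\<lambda>_. True) X (top_of_set SO) a a1"
    by (simp add: comp_def a1_def[abs_def] u_def e_def)
  then have "continuous_map X (top_of_set SO) a1"
    using homotopic_with_imp_continuous_maps by blast
  from homotopic_with_compose_continuous_map_right[OF homotopic_turn_left[OF p(1) e p(3)] this, where q = "\<lambda>_. True"]
  have h2: "homotopic_with (\<lambda>_. True) X (top_of_set SO) a1 a'"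
    by (simp add: comp_def a'_def[abs_def])
  \<comment> \<open>A new column is a function of two old ones, itself and column \<open>k\<close>.
    Hence equality of columns at two points and differentiability along the pieces both pass to
    \<open>a'\<close>.\<close>
  have a'_eq: "a' x *v y = turn p e 1 *v (turn (u x) p 1 *v (a x *v y))" for x y
    by (simp add: a'_def a1_def matrix_vector_mul_assoc)
  show thesis
  proof
    show "homotopic_with (\<lambda>_. True) X (top_of_set SO) a a'"
      using h1 h2 by (rule homotopic_with_trans)
    show "a' x *v axis i 1 = axis i 1" if x: "x \<in> topspace X" and "i \<in> insert k K" for x i
    proof (cases "i = k")
      case True
      have "turn (u x) p 1 *v u x = p" "turn p e 1 *v p = e"
        using turn_1 u[OF x] p e u_avoid[OF x] by auto
      then show ?thesis
        by (simp add: True a'_eq flip: u_def e_def)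
    next
      case False
      then have i: "i \<in> K" using that by simp
      \<comment> \<open>Columns of an orthogonal matrix are orthogonal, so the turn of column
        \<open>k\<close> does not move the standard basis vectors reached before.\<close>
      have "u x \<bullet> axis i 1 = (a x *v e) \<bullet> (a x *v axis i 1)"
        using fixed[OF x i] by (simp add: u_def)
      also have "\<dots> = 0"
        using SO_inner[OF aSO[OF x]] False by (simp add: e_def inner_axis_axis)
      finally have "turn (u x) p 1 *v axis i 1 = axis i 1"
        using p(2)[OF i] by (intro turn_fixes) auto
      moreover have "turn p e 1 *v axis i 1 = axis i 1"
        using p(2)[OF i] False by (intro turn_fixes) (auto simp: e_def inner_axis_axis)
      ultimately show ?thesis
        using fixed[OF x i] by (simp add: a'_eq)
    qed
    have "(\<lambda>w. a' (\<sigma> j w) *v axis i 1) differentiable_on D" if "j \<in> J" "i \<in> I" for j i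
    proof -
      have d: "(\<lambda>w. u (\<sigma> j w)) differentiable_on D" "(\<lambda>w. a (\<sigma> j w) *v axis i 1) differentiable_on D"
        using pieces that K(2) by (auto simp: pieces_for_def u_def e_def)
      have [simp]: "u (\<sigma> j w) \<noteq> 0" "u (\<sigma> j w) + p \<noteq> 0" if "w \<in> D" for w
        using avoid[OF \<open>j \<in> J\<close> that] u[of "\<sigma> j w"] pieces \<open>j \<in> J\<close> that
        by (auto simp: pieces_for_def eq_neg_iff_add_eq_0)
      have [simp]: "p \<noteq> 0" "p + e \<noteq> 0"
        using p by (auto simp: eq_neg_iff_add_eq_0)
      show ?thesis
        unfolding a'_eq turn_def matrix_vector_mul_assoc[symmetric] using d
        by (auto intro!: differentiable_on_reflection_mult differentiable_on_add differentiable_on_const)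
    qed
    moreover have "\<exists>j\<in>J. \<exists>w\<in>D. \<forall>i\<in>I. a' x *v axis i 1 = a' (\<sigma> j w) *v axis i 1"
      if x: "x \<in> topspace X" for x
    proof -
      obtain j w where jw: "j \<in> J" "w \<in> D" "\<forall>i\<in>I. a x *v axis i 1 = a (\<sigma> j w) *v axis i 1"
        using pieces x by (auto simp: pieces_for_def)
      then have "u x = u (\<sigma> j w)"
        using K(2) by (simp add: u_def e_def)
      then show ?thesis
        using jw by (auto simp: a'_eq)
    qed
    ultimately show "pieces_for (topspace X) D J \<sigma> I a'"
      using pieces by (simp add: pieces_for_def)
  qed
qed

lemma compress:
  fixes a :: "'x \<Rightarrow> real ^ 'n ^ 'n"
  assumes a: "continuous_map X (top_of_set SO) a"
    and J: "finite J" and W: "subspace W" "D \<subseteq> W"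
    and pieces: "pieces_for (topspace X) D J \<sigma> I a"
    and dim: "dim W + card I < CARD('n)"
  obtains a' where "homotopic_with (\<lambda>_. True) X (top_of_set SO) a a'"
    "\<And>x i. x \<in> topspace X \<Longrightarrow> i \<in> I \<Longrightarrow> a' x *v axis i 1 = axis i 1"
proof -
  have "\<exists>a'. homotopic_with (\<lambda>_. True) X (top_of_set SO) a a' \<and> pieces_for (topspace X) D J \<sigma> I a' \<and>
      (\<forall>x\<in>topspace X. \<forall>i\<in>K. a' x *v axis i 1 = axis i 1)" if "K \<subseteq> I" for K
    using finite[of K] that
  proof (induction K rule: finite_subset_induct')
    case empty
    then show ?case
      using a pieces by (auto intro!: exI[of _ a])
  next
    case (insert k K)
    then obtain a1 where a1: "homotopic_with (\<lambda>_. True) X (top_of_set SO) a a1"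
      "pieces_for (topspace X) D J \<sigma> I a1" "\<forall>x\<in>topspace X. \<forall>i\<in>K. a1 x *v axis i 1 = axis i 1"
      by blast
    \<comment> \<open>One column of \<open>I\<close> is still missing from \<open>K\<close>; this
      provides the extra dimension that the cone consumes.\<close>
    have "card K < card I"
      using insert by (intro psubset_card_mono) auto
    then have "dim W + card K + 1 < CARD('n)"
      using dim by linarith
    with compress_step[OF _ J W a1(2) insert(3,2,4)] a1
    obtain a' where "homotopic_with (\<lambda>_. True) X (top_of_set SO) a1 a'"
      "pieces_for (topspace X) D J \<sigma> I a'"
      "\<And>x i. x \<in> topspace X \<Longrightarrow> i \<in> insert k K \<Longrightarrow> a' x *v axis i 1 = axis i 1"
      using homotopic_with_imp_continuous_maps by metis
    then show ?case
      using a1(1) homotopic_with_trans by blast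
  qed
  from this[OF order_refl] that show thesis by blast
qed

section \<open>Moving basis vectors into a subspace\<close>

text \<open>Multiplying by \<open>P\<close> on the right makes the relevant columns the images of
  vectors in \<open>V\<close>, where the map is constant on cosets of the torus. As \<open>P\<close>
  is a product of turns, it is joined to the identity and the homotopy class does not
  change.\<close>

lemma rotation_into_subspace:
  fixes V :: "(real ^ 'n) set"
  assumes V: "subspace V" and "card K \<le> dim V"
  obtains P :: "real ^ 'n ^ 'n" where "P \<in> SO" "\<And>i. i \<in> K \<Longrightarrow> P *v axis i 1 \<in> V"
    "homotopic_with (\<lambda>_. True) (top_of_set SO) (top_of_set SO) (\<lambda>M. M) (\<lambda>M. M ** P)"
proof -
  have "\<exists>P \<in> SO. (\<forall>i\<in>K. P *v axis i 1 \<in> V) \<and>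
      homotopic_with (\<lambda>_. True) (top_of_set SO) (top_of_set SO) (\<lambda>M. M) (\<lambda>M. M ** P)"
    using finite[of K] assms(2)
  proof (induction K)
    case empty
    show ?case
      by (intro bexI[of _ "mat 1"]) (auto simp: SO_def rotation_matrix_def orthogonal_matrix_id)
  next
    case (insert k K)
    then obtain P where P: "P \<in> SO" "\<forall>i\<in>K. P *v axis i 1 \<in> V"
      "homotopic_with (\<lambda>_. True) (top_of_set SO) (top_of_set SO) (\<lambda>M. M) (\<lambda>M. M ** P)"
      by auto
    define E where "E = (\<lambda>i. P *v axis i 1) ` K"
    have "dim E \<le> card K"
      unfolding E_def by (intro order_trans[OF dim_le_card'] card_image_le) auto
    then have "dim (span E) < dim V"
      using insert by simp
    moreover have "span E \<subseteq> V"
      using P(2) V by (intro span_minimal) (auto simp: E_def)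
    ultimately have "span E \<subset> span V"
      using V by (metis psubsetI order_less_irrefl span_eq_iff)
    then obtain v' where v': "v' \<noteq> 0" "v' \<in> V" "\<And>y. y \<in> E \<Longrightarrow> orthogonal v' y"
      using orthogonal_to_subspace_exists_gen[of E V] V by (metis span_base span_eq_iff)
    define e where "e = P *v axis k 1"
    have e: "norm e = 1" using P(1) by (simp add: e_def SO_norm)
    have v0: "norm (v' /\<^sub>R norm v') = 1" using v' by simp
    have "v' /\<^sub>R norm v' \<noteq> - (v' /\<^sub>R norm v')"
      using v0 by (metis eq_neg_iff_add_eq_0 norm_zero scaleR_2 scaleR_eq_0_iff zero_neq_numeral zero_neq_one)
    \<comment> \<open>A turn starting at \<open>e\<close> needs a target other than
      \<open>- e\<close>. Both unit vectors on the line of \<open>v'\<close> qualify otherwise, and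
      at most one of them is excluded.\<close>
    define v where "v = (if e = - (v' /\<^sub>R norm v') then - (v' /\<^sub>R norm v') else v' /\<^sub>R norm v')"
    have v: "norm v = 1" "e \<noteq> - v" "v \<in> V" "\<And>y. y \<in> E \<Longrightarrow> v \<bullet> y = 0"
      using v0 e v' V \<open>v' /\<^sub>R norm v' \<noteq> - (v' /\<^sub>R norm v')\<close>
      by (auto simp: v_def orthogonal_def subspace_neg subspace_scale)
    show ?case
    proof (intro bexI[of _ "turn e v 1 ** P"] conjI ballI)
      show "turn e v 1 ** P \<in> SO"
        using e v P(1) by (intro SO_mult turn_SO) auto
      show "homotopic_with (\<lambda>_. True) (top_of_set SO) (top_of_set SO) (\<lambda>M. M) (\<lambda>M. M ** (turn e v 1 ** P))"
        using P(3) homotopic_turn_right[OF e v(1,2) P(1)] by (rule homotopic_with_trans)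
      show "turn e v 1 ** P *v axis i 1 \<in> V" if "i \<in> insert k K" for i
      proof (cases "i = k")
        case True
        then show ?thesis
          using turn_1[OF e v(1,2)] v(3) by (simp add: e_def flip: matrix_vector_mul_assoc)
      next
        case False
        then have i: "i \<in> K" using that by simp
        have "e \<bullet> (P *v axis i 1) = 0"
          using SO_inner[OF P(1)] False by (simp add: e_def inner_axis_axis)
        then have "turn e v 1 *v (P *v axis i 1) = P *v axis i 1"
          using v(4) i by (intro turn_fixes) (auto simp: E_def)
        then show ?thesis
          using P(2) i by (simp flip: matrix_vector_mul_assoc)
      qed
    qed
  qed
  with that show thesis by blast
qed

lemma homotopic_into_standard_SO_if_pieces:
  fixes a :: "'x \<Rightarrow> real ^ 'n::{finite, linorder} ^ 'n::{finite, linorder}"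
    and W V :: "(real ^ 'n::{finite, linorder}) set"
  assumes a: "continuous_map X (top_of_set SO) a"
    and J: "finite J" and W: "subspace W" "D \<subseteq> W" and V: "subspace V"
    and \<sigma>: "\<And>j w. j \<in> J \<Longrightarrow> w \<in> D \<Longrightarrow> \<sigma> j w \<in> topspace X"
    and cover: "\<And>x. x \<in> topspace X \<Longrightarrow> \<exists>j\<in>J. \<exists>w\<in>D. \<forall>v\<in>V. a x *v v = a (\<sigma> j w) *v v"
    and diff: "\<And>j v. j \<in> J \<Longrightarrow> (\<lambda>w. a (\<sigma> j w) *v v) differentiable_on D"
    and dim: "dim W + dim V \<le> CARD('n)" "q < dim V"
  shows "homotopic_into_standard_SO X (CARD('n) - q) a"
proof -
  \<comment> \<open>The double truncated subtraction is the bound in \<open>standard_SO\<close> for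
    the dimension \<open>CARD('n) - q\<close>; it is at most \<open>q\<close>.\<close>
  define I :: "'n::{finite, linorder} set" where "I = {i. card {j. j < i} < CARD('n) - (CARD('n) - q)}"
  have "inj_on (\<lambda>i. card {j. j < i}) I"
  proof (rule linorder_inj_onI')
    fix i j :: "'n::{finite, linorder}" assume "i < j"
    then have "{l. l < i} \<subset> {l. l < j}" by auto
    then have "card {l. l < i} < card {l. l < j}" by (intro psubset_card_mono) auto
    then show "card {l. l < i} \<noteq> card {l. l < j}" by simp
  qed
  moreover have "(\<lambda>i. card {j. j < i}) ` I \<subseteq> {..<q}"
    by (auto simp: I_def)
  ultimately have "card I \<le> q"
    by (metis card_inj_on_le card_lessThan finite_lessThan)
  then obtain P where P: "P \<in> SO" "\<And>i. i \<in> I \<Longrightarrow> P *v axis i 1 \<in> V"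
    "homotopic_with (\<lambda>_. True) (top_of_set SO) (top_of_set SO) (\<lambda>M. M) (\<lambda>M. M ** P)"
    using rotation_into_subspace[OF V, of I] dim(2) by auto
  from homotopic_with_compose_continuous_map_right[OF P(3) a, where q = "\<lambda>_. True"]
  have h: "homotopic_with (\<lambda>_. True) X (top_of_set SO) a (\<lambda>x. a x ** P)"
    by (simp add: comp_def)
  have "pieces_for (topspace X) D J \<sigma> I (\<lambda>x. a x ** P)"
    unfolding pieces_for_def matrix_vector_mul_assoc[symmetric] using \<sigma> cover diff P(2) by meson
  \<comment> \<open>The strict inequality \<open>q < dim V\<close> is spent here, on the dimension
    added by the cone.\<close>
  moreover have "dim W + card I < CARD('n)"
    using \<open>card I \<le> q\<close> dim by linarith
  moreover have "continuous_map X (top_of_set SO) (\<lambda>x. a x ** P)"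
    using h homotopic_with_imp_continuous_maps by blast
  ultimately obtain a' where a': "homotopic_with (\<lambda>_. True) X (top_of_set SO) (\<lambda>x. a x ** P) a'"
    "\<And>x i. x \<in> topspace X \<Longrightarrow> i \<in> I \<Longrightarrow> a' x *v axis i 1 = axis i 1"
    using compress[OF _ J W] by blast
  have "a' ` topspace X \<subseteq> SO"
    using homotopic_with_imp_continuous_maps[OF a'(1)] by (auto simp: continuous_map_in_subtopology)
  then have "a' ` topspace X \<subseteq> standard_SO (CARD('n) - q)"
    using a'(2) by (auto simp: standard_SO_def I_def)
  then show ?thesis
    unfolding homotopic_into_standard_SO_def using homotopic_with_trans[OF h a'(1)] by blast
qed

section \<open>Lie groups in charts\<close>

text \<open>A function differentiable at \<open>p\<close> and vanishing there is O(|y - p|), so the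
  factor \<open>e\<close> makes the product o(|y - p|). Only the limit of \<open>e\<close> enters;
  this allows \<open>e\<close> to contain the very function whose differentiability is
  sought.\<close>

lemma tendsto_zero_scaleR_has_derivative:
  fixes h :: "'a::real_normed_vector \<Rightarrow> 'b::real_normed_vector" and e :: "'a \<Rightarrow> real"
  assumes h: "(h has_derivative h') (at p)" "h p = 0" and e: "(e \<longlongrightarrow> 0) (at p)"
  shows "((\<lambda>y. e y *\<^sub>R h y) has_derivative (\<lambda>_. 0)) (at p)"
proof -
  obtain B where B: "\<And>x. norm (h' x) \<le> norm x * B"
    using has_derivative_bounded_linear[OF h(1)] bounded_linear.bounded by blast
  obtain d where d: "d > 0" "\<And>y. norm (y - p) < d \<Longrightarrow> norm (h y - h p - h' (y - p)) \<le> 1 * norm (y - p)"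
    using h(1) unfolding has_derivative_at_alt by (metis zero_less_one)
  have bound: "norm (h y) \<le> (B + 1) * norm (y - p)" if "norm (y - p) < d" for y
  proof -
    have "norm (h y) \<le> norm (h y - h p - h' (y - p)) + norm (h' (y - p))"
      using h(2) norm_triangle_sub[of "h y" "h' (y - p)"] by simp
    then show ?thesis
      using d(2)[OF that] B[of "y - p"] by (simp add: algebra_simps)
  qed
  have "((\<lambda>y. \<bar>e y\<bar> * (B + 1)) \<longlongrightarrow> 0) (at p)"
    using e tendsto_mult_left_zero[of "\<lambda>y. \<bar>e y\<bar>" "at p" "B + 1"] by (simp add: tendsto_rabs_zero)
  moreover have "\<forall>\<^sub>F y in at p. norm (norm (e y *\<^sub>R h y) / norm (y - p)) \<le> \<bar>e y\<bar> * (B + 1)"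
    unfolding eventually_at
  proof (intro exI[of _ d] conjI ballI impI)
    fix y assume "y \<noteq> p \<and> dist y p < d"
    then have y: "norm (y - p) < d" "norm (y - p) > 0" by (auto simp: dist_norm)
    then show "norm (norm (e y *\<^sub>R h y) / norm (y - p)) \<le> \<bar>e y\<bar> * (B + 1)"
      using mult_left_mono[OF bound[OF y(1)], of "\<bar>e y\<bar>"] by (simp add: field_simps)
  qed (use d in auto)
  ultimately have "((\<lambda>y. norm (e y *\<^sub>R h y) / norm (y - p)) \<longlongrightarrow> 0) (at p)"
    by (rule Lim_null_comparison[rotated])
  then show ?thesis
    using h(2) by (simp add: has_derivative_iff_norm)
qed

lemma tendsto_zero_bounded_scaleR:
  fixes h :: "'a::real_normed_vector \<Rightarrow> 'b::real_normed_vector" and e :: "'a \<Rightarrow> real"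
  assumes h: "(h \<longlongrightarrow> 0) F" and e: "\<forall>\<^sub>F y in F. \<bar>e y\<bar> \<le> C"
  shows "((\<lambda>y. e y *\<^sub>R h y) \<longlongrightarrow> 0) F"
proof (rule Lim_null_comparison)
  show "\<forall>\<^sub>F y in F. norm (e y *\<^sub>R h y) \<le> C * norm (h y)"
    using e by eventually_elim (simp add: mult_right_mono)
  show "((\<lambda>y. C * norm (h y)) \<longlongrightarrow> 0) F"
    using tendsto_mult_right_zero[OF tendsto_norm_zero[OF h], of C] by simp
qed

section \<open>Charts and coordinate expressions\<close>

lemma smooth_on_differentiable:
  assumes "smooth_on S f" "x \<in> S"
  shows "f differentiable (at x)"
proof -
  have "Ck_on (Suc 0) S f" using assms(1) by (simp only: smooth_on_def)
  then show ?thesis using assms(2) unfolding Ck_on.simps by (elim conjE bspec)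
qed

text \<open>The matrix of \<open>Ad\<close> is determined by first derivatives of the
  multiplication, so differentiating it takes second derivatives.\<close>

lemma smooth_on_differentiable2:
  assumes "smooth_on S f" "x \<in> S"
  shows "(\<lambda>x. frechet_derivative f (at x) v) differentiable (at x)"
proof -
  have "Ck_on (Suc (Suc 0)) S f" using assms(1) by (simp only: smooth_on_def)
  then have "Ck_on (Suc 0) S (\<lambda>x. frechet_derivative f (at x) v)" by (metis Ck_on.simps(2))
  then show ?thesis using assms(2) unfolding Ck_on.simps by (elim conjE bspec)
qed

lemma smooth_chart_openin: "smooth_chart X A c \<Longrightarrow> openin X (fst c)"
  and smooth_chart_open: "smooth_chart X A c \<Longrightarrow> open (snd c ` fst c)"
  by (simp_all add: smooth_chart_def)

lemma smooth_chart_subset: "smooth_chart X A c \<Longrightarrow> fst c \<subseteq> topspace X"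
  by (simp add: openin_subset smooth_chart_openin)

lemma smooth_chart_inj:
  assumes "smooth_chart X A c"
  shows "inj_on (snd c) (fst c)"
proof -
  have "inj_on (snd c) (topspace (subtopology X (fst c)))"
    using assms unfolding smooth_chart_def by (blast intro: homeomorphic_imp_injective_map)
  then show ?thesis
    using smooth_chart_subset[OF assms] by (simp add: inf.absorb2)
qed

lemma smooth_chart_inv:
  assumes "smooth_chart X A c" "x \<in> fst c"
  shows "inv_into (fst c) (snd c) (snd c x) = x"
  using assms by (simp add: smooth_chart_inj)

lemma smooth_chart_continuous:
  assumes "smooth_chart X A c"
  shows "continuous_map (subtopology X (fst c)) euclidean (snd c)"
  using assms homeomorphic_imp_continuous_map[of _ "top_of_set (snd c ` fst c)"]
  by (auto simp: smooth_chart_def continuous_map_in_subtopology)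

lemma smooth_chart_image_open:
  assumes c: "smooth_chart X A c" and V: "openin X V"
  shows "open (snd c ` (fst c \<inter> V))"
proof -
  have "openin (subtopology X (fst c)) (fst c \<inter> V)"
    using V by (metis openin_subtopology_Int2 inf_commute)
  then have "openin (top_of_set (snd c ` fst c)) (snd c ` (fst c \<inter> V))"
    using c homeomorphic_imp_open_map unfolding smooth_chart_def open_map_def by blast
  then show ?thesis
    using smooth_chart_open[OF c] openin_open_trans by blast
qed

lemma smooth_chart_inv_continuous:
  assumes c: "smooth_chart X A c"
  shows "continuous_map (top_of_set (snd c ` fst c)) X (inv_into (fst c) (snd c))"
proof -
  obtain g where g: "homeomorphic_maps (subtopology X (fst c)) (top_of_set (snd c ` fst c)) (snd c) g"
    using c homeomorphic_map_maps unfolding smooth_chart_def by blast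
  then have "continuous_map (top_of_set (snd c ` fst c)) X g"
    by (metis homeomorphic_maps_def continuous_map_in_subtopology)
  moreover have "g y = inv_into (fst c) (snd c) y" if y: "y \<in> snd c ` fst c" for y
  proof -
    obtain x where x: "x \<in> fst c" "y = snd c x" using y by blast
    then have "g y = x"
      using g smooth_chart_subset[OF c] by (auto simp: homeomorphic_maps_def)
    then show ?thesis using smooth_chart_inv[OF c x(1)] x(2) by simp
  qed
  ultimately show ?thesis
    by (rule continuous_map_eq) simp
qed

lemma smooth_chart_preimage_open:
  assumes c: "smooth_chart X A c" and V: "open V"
  shows "openin X {x \<in> fst c. snd c x \<in> V}"
proof -
  have "openin (subtopology X (fst c)) {x \<in> topspace (subtopology X (fst c)). snd c x \<in> V}"
    using V by (intro openin_continuous_map_preimage[OF smooth_chart_continuous[OF c]]) simp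
  then show ?thesis
    using smooth_chart_openin[OF c] smooth_chart_subset[OF c]
    by (simp add: openin_open_subtopology inf.absorb2)
qed

lemma in_charts_apply:
  "smooth_chart X A c \<Longrightarrow> x \<in> fst c \<Longrightarrow> in_charts c c' F (snd c x) = snd c' (F x)"
  by (simp add: in_charts_def smooth_chart_inv)

text \<open>The coordinate expressions compose only where \<open>F\<close> stays in the middle
  chart. By continuity of \<open>F\<close> this happens on an open set around \<open>x\<close>,
  which suffices for derivatives.\<close>

lemma in_charts_chain:
  assumes c: "smooth_chart X A c" and c': "smooth_chart X A c'" and x: "x \<in> fst c" "F x \<in> fst c'"
    and F: "continuous_map X X F"
    and D: "(in_charts c c' F has_derivative D) (at (snd c x))"
    and D': "(in_charts c' c'' H has_derivative D') (at (snd c' (F x)))"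
    and L: "\<And>y. y \<in> fst c \<Longrightarrow> L y = H (F y)"
  shows "(in_charts c c'' L has_derivative D' \<circ> D) (at (snd c x))"
proof (rule has_derivative_transform_within_open)
  show "(in_charts c' c'' H \<circ> in_charts c c' F has_derivative D' \<circ> D) (at (snd c x))"
    using D D' in_charts_apply[OF c x(1), of c' F] by (intro diff_chain_at) simp_all
  have "openin X {y \<in> topspace X. F y \<in> fst c'}"
    using F smooth_chart_openin[OF c'] by (rule openin_continuous_map_preimage)
  then show "open (snd c ` (fst c \<inter> {y \<in> topspace X. F y \<in> fst c'}))"
    by (rule smooth_chart_image_open[OF c])
  show "snd c x \<in> snd c ` (fst c \<inter> {y \<in> topspace X. F y \<in> fst c'})"
    using x smooth_chart_subset[OF c] by auto
  show "(in_charts c' c'' H \<circ> in_charts c c' F) y = in_charts c c'' L y"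
    if "y \<in> snd c ` (fst c \<inter> {y \<in> topspace X. F y \<in> fst c'})" for y
    using that L by (auto simp: in_charts_apply[OF c] in_charts_apply[OF c'])
qed

lemma in_charts_same_has_derivative:
  assumes c: "smooth_chart X A c" and x: "x \<in> fst c" and L: "\<And>y. y \<in> fst c \<Longrightarrow> L y = y"
  shows "(in_charts c c L has_derivative (\<lambda>v. v)) (at (snd c x))"
proof (rule has_derivative_transform_within_open[OF has_derivative_ident])
  show "open (snd c ` fst c)" by (rule smooth_chart_open[OF c])
qed (use x L in \<open>auto simp: in_charts_apply[OF c]\<close>)

text \<open>A chart adapted to a submanifold need not belong to the atlas, but it is compatible with
  every chart that does. So one member of the atlas among the two is enough.\<close>

lemma transition_has_derivative:
  assumes "smooth_chart X A c" "smooth_chart X A c'" "c \<in> A \<or> c' \<in> A" "x \<in> fst c" "x \<in> fst c'"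
  shows "(in_charts c c' id has_derivative frechet_derivative (in_charts c c' id) (at (snd c x))) (at (snd c x))"
proof -
  have "smooth_on (snd c ` (fst c \<inter> fst c')) (in_charts c c' id)"
    using assms(1-3) unfolding smooth_chart_def by (metis inf_commute)
  then show ?thesis
    using assms(4,5) by (intro iffD1[OF frechet_derivative_works] smooth_on_differentiable) auto
qed

lemma torus_commute:
  assumes T: "torus_in G X A k T" and t: "t \<in> T" "t' \<in> T"
  shows "t \<otimes>\<^bsub>G\<^esub> t' = t' \<otimes>\<^bsub>G\<^esub> t"
proof -
  let ?P = "product_group {..<k} (\<lambda>_. circle_group)"
  obtain F where F: "F \<in> iso ?P (G\<lparr>carrier := T\<rparr>)"
    using T unfolding torus_in_def by blast
  have "F ` carrier ?P = T"
    using F by (simp add: iso_def bij_betw_def)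
  then obtain a a' where a: "a \<in> carrier ?P" "t = F a" "a' \<in> carrier ?P" "t' = F a'"
    using t by blast
  have "a \<otimes>\<^bsub>?P\<^esub> a' = a' \<otimes>\<^bsub>?P\<^esub> a"
    by (simp add: product_group_def circle_group_def mult.commute)
  moreover have "F (a \<otimes>\<^bsub>?P\<^esub> a') = F a \<otimes>\<^bsub>G\<^esub> F a'" "F (a' \<otimes>\<^bsub>?P\<^esub> a) = F a' \<otimes>\<^bsub>G\<^esub> F a"
    using F a hom_mult[of F ?P "G\<lparr>carrier := T\<rparr>"] by (auto simp: iso_def)
  ultimately show ?thesis
    using a by simp
qed

locale lie_group_charts = group G
  for G :: "'g monoid" (structure)
    and X :: "'g topology"
    and A :: "('g, 'e::euclidean_space) chart set" +
  assumes lie: "lie_group G X A"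
begin

lemma top [simp]: "topspace X = carrier G"
  and atlas: "c \<in> A \<Longrightarrow> smooth_chart X A c"
  and mult_smooth_map: "smooth_map (prod_topology X X) (prod_atlas A A) X A (\<lambda>(x, y). x \<otimes> y)"
  using lie by (auto simp: lie_group_def smooth_manifold_def)

lemma chart_carrier: "smooth_chart X A c \<Longrightarrow> x \<in> fst c \<Longrightarrow> x \<in> carrier G"
  using smooth_chart_subset by fastforce

lemma chart_exists: "x \<in> carrier G \<Longrightarrow> \<exists>c\<in>A. x \<in> fst c"
  using lie by (auto simp: lie_group_def smooth_manifold_def)

lemma mult_continuous: "continuous_map (prod_topology X X) X (\<lambda>(x, y). x \<otimes> y)"
  using mult_smooth_map by (simp add: smooth_map_def)

lemma mult_left_continuous: "g \<in> carrier G \<Longrightarrow> continuous_map X X (\<lambda>x. g \<otimes> x)"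
  using continuous_map_compose[OF _ mult_continuous, of X "\<lambda>x. (g, x)"]
  by (simp add: comp_def continuous_map_pairwise)

lemma mult_right_continuous: "g \<in> carrier G \<Longrightarrow> continuous_map X X (\<lambda>x. x \<otimes> g)"
  using continuous_map_compose[OF _ mult_continuous, of X "\<lambda>x. (x, g)"]
  by (simp add: comp_def continuous_map_pairwise)

section \<open>The multiplication in coordinates\<close>

definition mult_in :: "('g, 'e) chart \<Rightarrow> ('g, 'e) chart \<Rightarrow> ('g, 'e) chart \<Rightarrow> 'e \<times> 'e \<Rightarrow> 'e" where
  "mult_in c1 c2 c3 =
     in_charts (fst c1 \<times> fst c2, map_prod (snd c1) (snd c2)) c3 (\<lambda>(x, y). x \<otimes> y)"

definition mult_dom :: "('g, 'e) chart \<Rightarrow> ('g, 'e) chart \<Rightarrow> ('g, 'e) chart \<Rightarrow> ('e \<times> 'e) set" where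
  "mult_dom c1 c2 c3 = {(snd c1 x, snd c2 y) |x y. x \<in> fst c1 \<and> y \<in> fst c2 \<and> x \<otimes> y \<in> fst c3}"

lemma mult_in_apply:
  assumes "c1 \<in> A" "c2 \<in> A" "x \<in> fst c1" "y \<in> fst c2"
  shows "mult_in c1 c2 c3 (snd c1 x, snd c2 y) = snd c3 (x \<otimes> y)"
proof -
  have "inj_on (map_prod (snd c1) (snd c2)) (fst c1 \<times> fst c2)"
    using assms by (intro map_prod_inj_on smooth_chart_inj[OF atlas])
  then have "inv_into (fst c1 \<times> fst c2) (map_prod (snd c1) (snd c2)) (map_prod (snd c1) (snd c2) (x, y)) = (x, y)"
    using assms by (intro inv_into_f_f) auto
  then show ?thesis
    by (simp add: mult_in_def in_charts_def)
qed

lemma mult_in_smooth: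
  assumes "c1 \<in> A" "c2 \<in> A" "c3 \<in> A"
  shows "smooth_on (mult_dom c1 c2 c3) (mult_in c1 c2 c3)"
proof -
  have "(fst c1 \<times> fst c2, map_prod (snd c1) (snd c2)) \<in> prod_atlas A A"
    using assms by (force simp: prod_atlas_def)
  then have "smooth_on (snd (fst c1 \<times> fst c2, map_prod (snd c1) (snd c2)) `
      {z \<in> fst (fst c1 \<times> fst c2, map_prod (snd c1) (snd c2)). (\<lambda>(x, y). x \<otimes> y) z \<in> fst c3}) (mult_in c1 c2 c3)"
    using mult_smooth_map assms(3) unfolding smooth_map_def mult_in_def by blast
  moreover have "snd (fst c1 \<times> fst c2, map_prod (snd c1) (snd c2)) `
      {z \<in> fst (fst c1 \<times> fst c2, map_prod (snd c1) (snd c2)). (\<lambda>(x, y). x \<otimes> y) z \<in> fst c3} = mult_dom c1 c2 c3"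
    by (auto simp: mult_dom_def image_iff)
  ultimately show ?thesis by simp
qed

lemma mult_dom_open:
  assumes c: "c1 \<in> A" "c2 \<in> A" "c3 \<in> A"
  shows "open (mult_dom c1 c2 c3)"
proof -
  let ?V1 = "snd c1 ` fst c1" and ?V2 = "snd c2 ` fst c2"
  define h where "h z = inv_into (fst c1) (snd c1) (fst z) \<otimes> inv_into (fst c2) (snd c2) (snd z)" for z
  have "continuous_map (prod_topology (top_of_set ?V1) (top_of_set ?V2)) X (inv_into (fst c1) (snd c1) \<circ> fst)"
    "continuous_map (prod_topology (top_of_set ?V1) (top_of_set ?V2)) X (inv_into (fst c2) (snd c2) \<circ> snd)"
    using c by (blast intro: continuous_map_compose continuous_map_fst continuous_map_snd
        smooth_chart_inv_continuous[OF atlas])+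
  then have "continuous_map (prod_topology (top_of_set ?V1) (top_of_set ?V2)) X
      ((\<lambda>(x, y). x \<otimes> y) \<circ> (\<lambda>z. (inv_into (fst c1) (snd c1) (fst z), inv_into (fst c2) (snd c2) (snd z))))"
    by (intro continuous_map_compose[OF _ mult_continuous]) (simp add: continuous_map_pairwise comp_def)
  then have "continuous_map (top_of_set (?V1 \<times> ?V2)) X h"
    by (simp add: comp_def h_def[abs_def] flip: subtopology_Times)
  then have "openin (top_of_set (?V1 \<times> ?V2)) {z \<in> topspace (top_of_set (?V1 \<times> ?V2)). h z \<in> fst c3}"
    using smooth_chart_openin[OF atlas[OF c(3)]] by (rule openin_continuous_map_preimage)
  moreover have "open (?V1 \<times> ?V2)"
    using c by (intro open_Times smooth_chart_open[OF atlas])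
  ultimately have "open {z \<in> ?V1 \<times> ?V2. h z \<in> fst c3}"
    by (simp add: openin_open_eq)
  moreover have "h (snd c1 x, snd c2 y) = x \<otimes> y" if "x \<in> fst c1" "y \<in> fst c2" for x y
    using that c by (simp add: h_def smooth_chart_inv[OF atlas])
  then have "{z \<in> ?V1 \<times> ?V2. h z \<in> fst c3} = mult_dom c1 c2 c3"
    by (fastforce simp: mult_dom_def)
  ultimately show ?thesis by simp
qed

lemma mult_in_has_derivative:
  assumes "c1 \<in> A" "c2 \<in> A" "c3 \<in> A" "x \<in> fst c1" "y \<in> fst c2" "x \<otimes> y \<in> fst c3"
  shows "(mult_in c1 c2 c3 has_derivative frechet_derivative (mult_in c1 c2 c3) (at (snd c1 x, snd c2 y)))
           (at (snd c1 x, snd c2 y))"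
  using assms by (intro iffD1[OF frechet_derivative_works] smooth_on_differentiable[OF mult_in_smooth])
    (auto simp: mult_dom_def)

lemma mult_left_has_derivative:
  assumes c: "c1 \<in> A" "c2 \<in> A" "c3 \<in> A" and x: "x \<in> fst c1" "y \<in> fst c2" "x \<otimes> y \<in> fst c3"
  shows "(in_charts c2 c3 (\<lambda>y. x \<otimes> y) has_derivative
           (\<lambda>v. frechet_derivative (mult_in c1 c2 c3) (at (snd c1 x, snd c2 y)) (0, v))) (at (snd c2 y))"
proof (rule has_derivative_transform_within_open)
  have "((\<lambda>v. (snd c1 x, v)) has_derivative (\<lambda>v. (0, v))) (at (snd c2 y))"
    by (intro derivative_intros)
  from diff_chain_at[OF this mult_in_has_derivative[OF c x]]
  show "((\<lambda>v. mult_in c1 c2 c3 (snd c1 x, v)) has_derivative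
           (\<lambda>v. frechet_derivative (mult_in c1 c2 c3) (at (snd c1 x, snd c2 y)) (0, v))) (at (snd c2 y))"
    by (simp add: comp_def)
  show "open (snd c2 ` fst c2)"
    by (rule smooth_chart_open[OF atlas[OF c(2)]])
qed (use c x in \<open>auto simp: in_charts_apply[OF atlas] mult_in_apply\<close>)

lemma mult_right_has_derivative:
  assumes c: "c1 \<in> A" "c2 \<in> A" "c3 \<in> A" and x: "x \<in> fst c1" "y \<in> fst c2" "x \<otimes> y \<in> fst c3"
  shows "(in_charts c1 c3 (\<lambda>x. x \<otimes> y) has_derivative
           (\<lambda>v. frechet_derivative (mult_in c1 c2 c3) (at (snd c1 x, snd c2 y)) (v, 0))) (at (snd c1 x))"
proof (rule has_derivative_transform_within_open)
  have "((\<lambda>v. (v, snd c2 y)) has_derivative (\<lambda>v. (v, 0))) (at (snd c1 x))"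
    by (intro derivative_intros)
  from diff_chain_at[OF this mult_in_has_derivative[OF c x]]
  show "((\<lambda>v. mult_in c1 c2 c3 (v, snd c2 y)) has_derivative
           (\<lambda>v. frechet_derivative (mult_in c1 c2 c3) (at (snd c1 x, snd c2 y)) (v, 0))) (at (snd c1 x))"
    by (simp add: comp_def)
  show "open (snd c1 ` fst c1)"
    by (rule smooth_chart_open[OF atlas[OF c(1)]])
qed (use c x in \<open>auto simp: in_charts_apply[OF atlas] mult_in_apply\<close>)

section \<open>Conjugation and the adjoint action at the identity\<close>

abbreviation conjugation :: "'g \<Rightarrow> 'g \<Rightarrow> 'g" where
  "conjugation g \<equiv> \<lambda>x. g \<otimes> x \<otimes> inv g"

lemma conjugation_continuous: "g \<in> carrier G \<Longrightarrow> continuous_map X X (conjugation g)"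
  using continuous_map_compose[OF mult_left_continuous mult_right_continuous, of g "inv g"]
  by (simp add: comp_def)

lemma conjugation_has_derivative:
  assumes c: "c \<in> charts_at A \<one>" "c' \<in> charts_at A \<one>" and g: "g \<in> carrier G"
  shows "(in_charts c c' (conjugation g) has_derivative
           frechet_derivative (in_charts c c' (conjugation g)) (at (snd c \<one>))) (at (snd c \<one>))"
proof -
  obtain d where d: "d \<in> A" "g \<in> fst d" using chart_exists[OF g] by blast
  obtain d' where d': "d' \<in> A" "inv g \<in> fst d'" using chart_exists[of "inv g"] g by auto
  have c_A: "c \<in> A" "c' \<in> A" "\<one> \<in> fst c" "\<one> \<in> fst c'" using c by (auto simp: charts_at_def)
  note L = mult_left_has_derivative[OF d(1) c_A(1) d(1) d(2) c_A(3)]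
  note R = mult_right_has_derivative[OF d(1) d'(1) c_A(2) d(2) d'(2)]
  have "(in_charts c c' (conjugation g) has_derivative
      (\<lambda>v. frechet_derivative (mult_in d d' c') (at (snd d g, snd d' (inv g))) (v, 0)) \<circ>
      (\<lambda>v. frechet_derivative (mult_in d c d) (at (snd d g, snd c \<one>)) (0, v))) (at (snd c \<one>))"
    using g d c_A L R
    by (intro in_charts_chain[OF atlas atlas _ _ mult_left_continuous]) auto
  then show ?thesis
    by (intro iffD1[OF frechet_derivative_works]) (auto simp: differentiable_def)
qed

lemma ex_chart_at_one: "\<exists>c. c \<in> charts_at A \<one>"
  using chart_exists[of \<one>] by (auto simp: charts_at_def)

text \<open>The same choice as the one made by \<open>tangent_map\<close> at \<one>, so that
  \<open>Ad\<close> unfolds to derivatives at \<open>p0\<close>.\<close>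

definition c0 :: "('g, 'e) chart" where
  "c0 = (SOME c. c \<in> charts_at A \<one>)"

lemma c0: "c0 \<in> charts_at A \<one>"
  unfolding c0_def by (rule someI_ex[OF ex_chart_at_one])

lemma c0_A [simp]: "c0 \<in> A" and one_c0 [simp]: "\<one> \<in> fst c0"
  using c0 by (auto simp: charts_at_def)

lemma c0_smooth: "smooth_chart X A c0"
  by (simp add: atlas)

abbreviation p0 :: 'e where "p0 \<equiv> snd c0 \<one>"

text \<open>A tangent vector at \<one> is determined by its coordinates in \<open>c0\<close>, so
  this map on a single coordinate space carries all the information in
  \<open>Ad G A g\<close>.\<close>

definition Ad0 :: "'g \<Rightarrow> 'e \<Rightarrow> 'e" where
  "Ad0 g = frechet_derivative (in_charts c0 c0 (conjugation g)) (at p0)"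

lemma Ad0_has_derivative:
  "g \<in> carrier G \<Longrightarrow> (in_charts c0 c0 (conjugation g) has_derivative Ad0 g) (at p0)"
  unfolding Ad0_def by (rule conjugation_has_derivative[OF c0 c0])

lemma Ad0_linear: "g \<in> carrier G \<Longrightarrow> linear (Ad0 g)"
  using Ad0_has_derivative has_derivative_linear by blast

lemma Ad0_mult:
  assumes "g \<in> carrier G" "h \<in> carrier G"
  shows "Ad0 (g \<otimes> h) v = Ad0 g (Ad0 h v)"
proof -
  have "conjugation (g \<otimes> h) x = conjugation g (conjugation h x)" if "x \<in> fst c0" for x
    using assms chart_carrier[OF c0_smooth that] by (simp add: inv_mult_group m_assoc)
  then have "(in_charts c0 c0 (conjugation (g \<otimes> h)) has_derivative Ad0 g \<circ> Ad0 h) (at p0)"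
    using assms Ad0_has_derivative[OF assms(1)] Ad0_has_derivative[OF assms(2)]
    by (intro in_charts_chain[OF c0_smooth c0_smooth _ _ conjugation_continuous, of _ h _ c0 "conjugation g"]) auto
  then show ?thesis
    using has_derivative_unique[OF Ad0_has_derivative, of "g \<otimes> h"] assms by (metis comp_apply m_closed)
qed

lemma Ad0_one: "Ad0 \<one> v = v"
proof -
  have "(in_charts c0 c0 (conjugation \<one>) has_derivative (\<lambda>v. v)) (at p0)"
    using chart_carrier[OF c0_smooth] by (intro in_charts_same_has_derivative[OF c0_smooth]) auto
  then show ?thesis
    using has_derivative_unique[OF Ad0_has_derivative[of \<one>]] by (metis one_closed)
qed

lemma tangent_space_outside: "v \<in> tangent_space A p \<Longrightarrow> c \<notin> charts_at A p \<Longrightarrow> v c = 0"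
  and tangent_space_transition:
    "v \<in> tangent_space A p \<Longrightarrow> c \<in> charts_at A p \<Longrightarrow> c' \<in> charts_at A p \<Longrightarrow>
      v c' = frechet_derivative (in_charts c c' id) (at (snd c p)) (v c)"
  unfolding tangent_space_def by blast+

lemma tangent_spaceI:
  "(\<And>c. c \<notin> charts_at A p \<Longrightarrow> v c = 0) \<Longrightarrow>
   (\<And>c c'. c \<in> charts_at A p \<Longrightarrow> c' \<in> charts_at A p \<Longrightarrow>
      v c' = frechet_derivative (in_charts c c' id) (at (snd c p)) (v c)) \<Longrightarrow> v \<in> tangent_space A p"
  unfolding tangent_space_def by blast

lemma tangent_space_lincomb:
  assumes "u \<in> tangent_space A \<one>" "v \<in> tangent_space A \<one>"
  shows "(\<lambda>c. s *\<^sub>R u c + t *\<^sub>R v c) \<in> tangent_space A \<one>"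
proof -
  have L: "linear (frechet_derivative (in_charts c c' id) (at (snd c \<one>)))"
    if "c \<in> charts_at A \<one>" "c' \<in> charts_at A \<one>" for c c'
    using that transition_has_derivative[OF atlas atlas, of c c' \<one>] has_derivative_linear
    by (auto simp: charts_at_def)
  show ?thesis
  proof (rule tangent_spaceI)
    fix c assume "c \<notin> charts_at A \<one>"
    from tangent_space_outside[OF assms(1) this] tangent_space_outside[OF assms(2) this]
    show "s *\<^sub>R u c + t *\<^sub>R v c = 0"
      by simp
  next
    fix c c' assume c: "c \<in> charts_at A \<one>" "c' \<in> charts_at A \<one>"
    note T = tangent_space_transition[OF assms(1) c] tangent_space_transition[OF assms(2) c]
    show "s *\<^sub>R u c' + t *\<^sub>R v c' =
        frechet_derivative (in_charts c c' id) (at (snd c \<one>)) (s *\<^sub>R u c + t *\<^sub>R v c)"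
      by (simp only: T linear_add[OF L[OF c]] linear_scale[OF L[OF c]])
  qed
qed

lemma tangent_space_eqI:
  assumes u: "u \<in> tangent_space A \<one>" and v: "v \<in> tangent_space A \<one>" and eq: "u c0 = v c0"
  shows "u = v"
proof
  fix c show "u c = v c"
  proof (cases "c \<in> charts_at A \<one>")
    case True
    show ?thesis
      by (simp only: tangent_space_transition[OF u c0 True] tangent_space_transition[OF v c0 True] eq)
  next
    case False
    then show ?thesis
      by (simp only: tangent_space_outside[OF u] tangent_space_outside[OF v] not_False_eq_True)
  qed
qed

lemma Ad_apply:
  assumes "g \<in> carrier G"
  shows "Ad G A g v c = (if c \<in> charts_at A \<one>
           then frechet_derivative (in_charts c0 c (conjugation g)) (at p0) (v c0) else 0)"
  using assms by (simp add: Ad_def tangent_map_def c0_def Let_def)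

lemma Ad_c0: "g \<in> carrier G \<Longrightarrow> Ad G A g v c0 = Ad0 g (v c0)"
  by (simp add: Ad_apply c0 Ad0_def)

text \<open>\<open>Ad G A g v\<close> is computed from \<open>v c0\<close> alone. Its transformation
  law is the chain rule for a coordinate change applied after the conjugation.\<close>

lemma Ad_tangent_space:
  assumes g: "g \<in> carrier G"
  shows "Ad G A g v \<in> tangent_space A \<one>"
proof -
  have chain: "frechet_derivative (in_charts c0 c' (conjugation g)) (at p0) w =
      frechet_derivative (in_charts c c' id) (at (snd c \<one>))
        (frechet_derivative (in_charts c0 c (conjugation g)) (at p0) w)"
    if c: "c \<in> charts_at A \<one>" "c' \<in> charts_at A \<one>" for c c' w
  proof -
    have c_A: "c \<in> A" "c' \<in> A" "\<one> \<in> fst c" "\<one> \<in> fst c'" using c by (auto simp: charts_at_def)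
    have "(in_charts c0 c' (conjugation g) has_derivative
        frechet_derivative (in_charts c c' id) (at (snd c \<one>)) \<circ>
        frechet_derivative (in_charts c0 c (conjugation g)) (at p0)) (at p0)"
      using g c_A conjugation_has_derivative[OF c0 c(1) g]
        transition_has_derivative[OF atlas[OF c_A(1)] atlas[OF c_A(2)]]
      by (intro in_charts_chain[OF c0_smooth atlas _ _ conjugation_continuous, of _ _ g _ _ id]) auto
    then show ?thesis
      using has_derivative_unique[OF conjugation_has_derivative[OF c0 c(2) g]] by (metis comp_apply)
  qed
  show ?thesis
  proof (rule tangent_spaceI)
    fix c c' assume c: "c \<in> charts_at A \<one>" "c' \<in> charts_at A \<one>"
    show "Ad G A g v c' = frechet_derivative (in_charts c c' id) (at (snd c \<one>)) (Ad G A g v c)"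
      using chain[OF c] c by (simp only: Ad_apply[OF g] if_True)
  qed (simp only: Ad_apply[OF g] if_False)
qed

text \<open>Conjugation by \<open>t\<close> fixes the curve in \<open>S\<close> whose coordinates in the adapted chart are
  \<open>snd c \<one> + s w\<close>.\<close>

lemma Ad0_fixes_tangent:
  assumes c: "smooth_chart X A c" "\<one> \<in> fst c" and W: "subspace W"
    and S: "snd c ` (fst c \<inter> S) = snd c ` fst c \<inter> W" "\<one> \<in> S"
    and t: "t \<in> carrier G" "\<And>x. x \<in> S \<Longrightarrow> x \<in> carrier G \<Longrightarrow> t \<otimes> x = x \<otimes> t"
    and w: "w \<in> W"
  shows "Ad0 t (frechet_derivative (in_charts c c0 id) (at (snd c \<one>)) w) =
    frechet_derivative (in_charts c c0 id) (at (snd c \<one>)) w"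
proof -
  define \<gamma> where "\<gamma> s = in_charts c c0 id (snd c \<one> + s *\<^sub>R w)" for s :: real
  let ?J = "frechet_derivative (in_charts c c0 id) (at (snd c \<one>))"
  have J: "(in_charts c c0 id has_derivative ?J) (at (snd c \<one>))"
    using c by (intro transition_has_derivative[OF c(1) c0_smooth]) auto
  have "((\<lambda>s :: real. snd c \<one> + s *\<^sub>R w) has_derivative (\<lambda>s. s *\<^sub>R w)) (at 0)"
    by (auto intro!: derivative_eq_intros)
  then have "(in_charts c c0 id \<circ> (\<lambda>s. snd c \<one> + s *\<^sub>R w) has_derivative ?J \<circ> (\<lambda>s. s *\<^sub>R w)) (at 0)"
    using J by (intro diff_chain_at) simp_all
  then have \<gamma>: "(\<gamma> has_derivative (\<lambda>s. ?J (s *\<^sub>R w))) (at 0)"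
    by (simp add: \<gamma>_def[abs_def] comp_def)
  have \<gamma>0: "\<gamma> 0 = p0"
    by (simp add: \<gamma>_def in_charts_apply[OF c])
  have "(in_charts c0 c0 (conjugation t) \<circ> \<gamma> has_derivative Ad0 t \<circ> (\<lambda>s. ?J (s *\<^sub>R w))) (at 0)"
    using Ad0_has_derivative[OF t(1)] by (intro diff_chain_at[OF \<gamma>]) (simp add: \<gamma>0)
  moreover have "(in_charts c0 c0 (conjugation t) \<circ> \<gamma> has_derivative (\<lambda>s. ?J (s *\<^sub>R w))) (at 0)"
  proof (rule has_derivative_transform_within_open[OF \<gamma>])
    let ?O = "snd c ` (fst c \<inter> fst c0)"
    have "open ?O"
      by (rule smooth_chart_image_open[OF c(1) smooth_chart_openin[OF c0_smooth]])
    then show "open ((\<lambda>s :: real. snd c \<one> + s *\<^sub>R w) -` ?O)"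
      by (intro open_vimage continuous_intros)
    show "(0 :: real) \<in> (\<lambda>s. snd c \<one> + s *\<^sub>R w) -` ?O"
      using c by simp
    fix s :: real assume "s \<in> (\<lambda>s. snd c \<one> + s *\<^sub>R w) -` ?O"
    then obtain x where x: "x \<in> fst c" "x \<in> fst c0" "snd c \<one> + s *\<^sub>R w = snd c x"
      by auto
    have "snd c \<one> \<in> W"
      using S c by blast
    then have "snd c x \<in> W"
      using W w x(3) by (metis subspace_add subspace_scale)
    then have "snd c x \<in> snd c ` (fst c \<inter> S)"
      using S x by blast
    then have xS: "x \<in> S"
      using smooth_chart_inj[OF c(1)] x(1) by (auto simp: inj_on_def)
    have "x \<in> carrier G"
      using chart_carrier[OF c(1) x(1)] .
    then have "conjugation t x = x"
      using t xS by (simp add: m_assoc)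
    then show "\<gamma> s = (in_charts c0 c0 (conjugation t) \<circ> \<gamma>) s"
      using x by (simp add: \<gamma>_def in_charts_apply[OF c(1)] in_charts_apply[OF c0_smooth])
  qed
  ultimately have "Ad0 t \<circ> (\<lambda>s. ?J (s *\<^sub>R w)) = (\<lambda>s. ?J (s *\<^sub>R w))"
    by (rule has_derivative_unique)
  from fun_cong[OF this, of 1] show ?thesis by simp
qed

section \<open>A slice transverse to a torus\<close>

text \<open>Multiplication by \<one> on either side is the identity, which gives both partial
  derivatives; linearity adds them up.\<close>

lemma mult_in_derivative_one:
  "frechet_derivative (mult_in c0 c0 c0) (at (p0, p0)) (v, 0) = v"
  "frechet_derivative (mult_in c0 c0 c0) (at (p0, p0)) (0, v) = v"
  "frechet_derivative (mult_in c0 c0 c0) (at (p0, p0)) (v, w) = v + w"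
proof -
  let ?D = "frechet_derivative (mult_in c0 c0 c0) (at (p0, p0))"
  have id: "(in_charts c0 c0 (\<lambda>x. x \<otimes> \<one>) has_derivative (\<lambda>v. v)) (at p0)"
    "(in_charts c0 c0 (\<lambda>x. \<one> \<otimes> x) has_derivative (\<lambda>v. v)) (at p0)"
    using chart_carrier[OF c0_smooth] by (auto intro: in_charts_same_has_derivative[OF c0_smooth])
  have R: "(in_charts c0 c0 (\<lambda>x. x \<otimes> \<one>) has_derivative (\<lambda>v. ?D (v, 0))) (at p0)"
    by (rule mult_right_has_derivative) auto
  have L: "(in_charts c0 c0 (\<lambda>x. \<one> \<otimes> x) has_derivative (\<lambda>v. ?D (0, v))) (at p0)"
    by (rule mult_left_has_derivative) auto
  show 1: "?D (v, 0) = v" for v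
    using fun_cong[OF has_derivative_unique[OF R id(1)], of v] .
  show 2: "?D (0, v) = v" for v
    using fun_cong[OF has_derivative_unique[OF L id(2)], of v] .
  have "linear ?D"
    using mult_in_has_derivative[of c0 c0 c0 \<one> \<one>] has_derivative_linear by auto
  from linear_add[OF this, of "(v, 0)" "(0, w)"] show "?D (v, w) = v + w"
    by (simp add: 1 2)
qed

text \<open>\<open>V\<close> is the tangent space of the torus in the coordinates of
  \<open>c0\<close>, and \<open>W\<close> is a complement. The map \<open>f\<close> multiplies a
  group element displaced along \<open>W\<close> by an element of the torus displaced along
  \<open>V\<close>. Its derivative at 0 is the identity, so its values fill a neighbourhood of
  \<one>.\<close>

lemma torus_slice:
  assumes T: "torus_in G X A r T"
  obtains V W N where "subspace V" "dim V = r" "subspace W" "dim W + r \<le> DIM('e)"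
    "openin X N" "\<one> \<in> N"
    "\<And>t v. t \<in> T \<Longrightarrow> v \<in> V \<Longrightarrow> Ad0 t v = v"
    "\<And>g. g \<in> N \<Longrightarrow> \<exists>s\<in>fst c0. \<exists>t\<in>T. snd c0 s - p0 \<in> W \<and> g = s \<otimes> t"
proof -
  have subgroup: "subgroup T G"
    using T by (simp add: torus_in_def)
  then have one_T: "\<one> \<in> T" and T_carrier: "T \<subseteq> carrier G"
    using subgroup.one_closed subgroup.subset by blast+
  obtain c W0 where c: "smooth_chart X A c" "\<one> \<in> fst c" and W0: "subspace W0" "dim W0 = r"
    and adapted: "snd c ` (fst c \<inter> T) = snd c ` fst c \<inter> W0"
    using T one_T unfolding torus_in_def embedded_submanifold_def by blast
  define p1 where "p1 = snd c \<one>"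
  \<comment> \<open>The adapted chart need not send \<one> to 0. Still, displacing \<open>p1\<close>
    by vectors of \<open>W0\<close> stays in \<open>W0\<close>, that is, in the torus as long as the
    chart reaches.\<close>
  have p1: "p1 \<in> W0"
    using adapted c one_T by (auto simp: p1_def)
  define J where "J = frechet_derivative (in_charts c c0 id) (at p1)"
  define J' where "J' = frechet_derivative (in_charts c0 c id) (at p0)"
  have J: "(in_charts c c0 id has_derivative J) (at p1)"
    unfolding J_def p1_def using c by (intro transition_has_derivative[OF c(1) c0_smooth]) auto
  have J': "(in_charts c0 c id has_derivative J') (at p0)"
    unfolding J'_def using c by (intro transition_has_derivative[OF c0_smooth c(1)]) auto
  have linJ: "linear J" and linJ': "linear J'"
    using J J' has_derivative_linear by blast+
  have "(in_charts c c id has_derivative J' \<circ> J) (at p1)"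
    using J J' c unfolding p1_def
    by (intro in_charts_chain[OF c(1) c0_smooth, where F = id and H = id]) auto
  moreover have "(in_charts c c id has_derivative (\<lambda>v. v)) (at p1)"
    using c unfolding p1_def by (intro in_charts_same_has_derivative) auto
  ultimately have J'J: "J' (J v) = v" for v
    using has_derivative_unique fun_cong by (metis comp_apply)
  define V where "V = J ` W0"
  have V: "subspace V"
    unfolding V_def using linJ W0 by (simp add: linear_subspace_image)
  have "inj J"
    using J'J by (metis injI)
  then have dimV: "dim V = r"
    unfolding V_def using W0 linJ by (metis dim_image_eq inj_on_subset subset_UNIV span_eq_iff)
  \<comment> \<open>A left inverse of the inclusion of \<open>V\<close> is a linear projection onto
    \<open>V\<close>; its kernel is the complement.\<close>
  obtain \<pi> :: "'e \<Rightarrow> 'e" where \<pi>: "linear \<pi>" "range \<pi> \<subseteq> V" "\<And>v. v \<in> V \<Longrightarrow> \<pi> v = v"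
    using linear_inj_on_left_inverse[OF linear_ident, of V] V by (auto simp: span_eq_iff[THEN iffD2])
  define W where "W = {x. \<pi> x = 0}"
  have W: "subspace W"
    unfolding W_def using \<pi>(1) by (simp add: linear_subspace_kernel)
  have "V \<inter> W = {0}"
    using \<pi> V subspace_0[OF V] by (auto simp: W_def linear_0)
  then have "dim V + dim W \<le> DIM('e)"
    using dim_sums_Int[OF V W] dim_subset_UNIV[of "{x + y |x y. x \<in> V \<and> y \<in> W}"] by simp
  then have dimW: "dim W + r \<le> DIM('e)"
    using dimV by simp
  have cont: "continuous_on B \<pi>" "continuous_on B (\<lambda>z. J' (\<pi> z))" for B
    using \<pi>(1) linear_compose[OF \<pi>(1) linJ']
    by (simp_all add: linear_continuous_on linear_conv_bounded_linear comp_def)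
  \<comment> \<open>\<open>u z\<close> is the first factor in the chart \<open>c0\<close>,
    \<open>q z\<close> the factor from the torus in the adapted chart \<open>c\<close>.\<close>
  define u where "u z = p0 + (z - \<pi> z)" for z
  define q where "q z = p1 + J' (\<pi> z)" for z
  define f where "f z = mult_in c0 c0 c0 (u z, in_charts c c0 id (q z))" for z
  define O1 where "O1 = snd c ` (fst c \<inter> fst c0)"
  have "open O1"
    unfolding O1_def by (rule smooth_chart_image_open[OF c(1) smooth_chart_openin[OF c0_smooth]])
  define S1 where "S1 = q -` O1"
  have contq: "continuous_on B q" and contu: "continuous_on B u" for B
    unfolding q_def u_def by (intro continuous_intros cont)+
  have "open S1"
    unfolding S1_def using \<open>open O1\<close> contq by (intro open_vimage) (auto simp: continuous_on_eq_continuous_at)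
  have diff_id: "in_charts c c0 id differentiable (at y)" if "y \<in> O1" for y
    using that transition_has_derivative[OF c(1) c0_smooth] unfolding O1_def differentiable_def by auto
  have "continuous_on O1 (in_charts c c0 id)"
    using diff_id by (intro differentiable_imp_continuous_on differentiable_at_imp_differentiable_on)
  then have "continuous_on S1 (\<lambda>z. in_charts c c0 id (q z))"
    using contq by (rule continuous_on_compose2) (auto simp: S1_def)
  then have cont_pair: "continuous_on S1 (\<lambda>z. (u z, in_charts c c0 id (q z)))"
    by (intro continuous_intros contu)
  \<comment> \<open>On \<open>S\<close> both factors and their product lie in the domains of the
    charts, so that \<open>f\<close> really describes a product in the group.\<close>
  define S where "S = {z \<in> S1. (u z, in_charts c c0 id (q z)) \<in> mult_dom c0 c0 c0}"
  have "open S"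
    using continuous_open_preimage[OF cont_pair \<open>open S1\<close> mult_dom_open[of c0 c0 c0]]
    by (simp add: S_def Int_def vimage_def)
  have "continuous_on (mult_dom c0 c0 c0) (mult_in c0 c0 c0)"
    using smooth_on_differentiable[OF mult_in_smooth[of c0 c0 c0]]
    by (intro differentiable_imp_continuous_on differentiable_at_imp_differentiable_on) auto
  then have contf: "continuous_on S f"
    unfolding f_def
    by (rule continuous_on_compose2[OF _ continuous_on_subset[OF cont_pair]]) (auto simp: S_def)
  have u0: "u 0 = p0" and q0: "q 0 = p1"
    using \<pi>(1) linJ' by (simp_all add: u_def q_def linear_0)
  have chart0: "in_charts c c0 id p1 = p0"
    unfolding p1_def using in_charts_apply[OF c, of c0 id] by (simp only: id_apply)
  have zero_S: "0 \<in> S"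
    using c by (auto simp: S_def S1_def O1_def u0 q0 chart0[unfolded p1_def] mult_dom_def p1_def intro!: exI[of _ \<one>])
  have f0: "f 0 = p0"
    using mult_in_apply[of c0 c0 \<one> \<one> c0] by (simp add: f_def u0 q0 chart0)
  have "(q has_derivative (\<lambda>z. J' (\<pi> z))) (at 0)"
    unfolding q_def using linear_compose[OF \<pi>(1) linJ']
    by (auto intro!: derivative_eq_intros linear_imp_has_derivative simp: comp_def)
  then have "(in_charts c c0 id \<circ> q has_derivative J \<circ> (\<lambda>z. J' (\<pi> z))) (at 0)"
    using J by (intro diff_chain_at) (simp_all add: q0)
  moreover have "(u has_derivative (\<lambda>z. z - \<pi> z)) (at 0)"
    unfolding u_def using \<pi>(1) by (auto intro!: derivative_eq_intros linear_imp_has_derivative)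
  ultimately have "((\<lambda>z. (u z, in_charts c c0 id (q z))) has_derivative (\<lambda>z. (z - \<pi> z, J (J' (\<pi> z))))) (at 0)"
    by (intro has_derivative_Pair) (simp_all add: comp_def)
  from diff_chain_at[OF this, of "mult_in c0 c0 c0" "frechet_derivative (mult_in c0 c0 c0) (at (p0, p0))"]
  have "(f has_derivative (\<lambda>z. (z - \<pi> z) + J (J' (\<pi> z)))) (at 0)"
    using mult_in_has_derivative[of c0 c0 c0 \<one> \<one>]
    by (simp add: u0 q0 chart0 f_def[abs_def] comp_def mult_in_derivative_one(3))
  moreover have JJ': "J (J' (\<pi> z)) = \<pi> z" "J' (\<pi> z) \<in> W0" for z
  proof -
    have "\<pi> z \<in> J ` W0" using \<pi>(2) by (auto simp: V_def)
    then show "J (J' (\<pi> z)) = \<pi> z" "J' (\<pi> z) \<in> W0" by (auto simp: J'J)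
  qed
  ultimately have f': "(f has_derivative (\<lambda>z. z)) (at 0)"
    by simp
  \<comment> \<open>Sussmann's theorem needs continuity on \<open>S\<close> and an invertible
    derivative at the single point 0.\<close>
  have "f 0 \<in> interior (f ` S)"
    using sussmann_open_mapping[OF \<open>open S\<close> contf zero_S f' bounded_linear_ident _ order_refl] zero_S
    by (simp add: interior_open \<open>open S\<close> comp_def id_def)
  define N where "N = {x \<in> fst c0. snd c0 x \<in> interior (f ` S)}"
  show thesis
  proof
    show "subspace V" "dim V = r" "subspace W" "dim W + r \<le> DIM('e)" by fact+
    show "openin X N"
      unfolding N_def by (rule smooth_chart_preimage_open[OF c0_smooth open_interior])
    show "\<one> \<in> N"
      using \<open>f 0 \<in> interior (f ` S)\<close> by (simp add: N_def f0)
    show "Ad0 t v = v" if t: "t \<in> T" and v: "v \<in> V" for t v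
    proof -
      obtain w where w: "w \<in> W0" "v = J w"
        using v by (auto simp: V_def)
      show ?thesis
        using Ad0_fixes_tangent[OF c W0(1) adapted one_T _ torus_commute[OF T t] w(1)] T_carrier t w(2)
        by (auto simp: J_def p1_def)
    qed
    show "\<exists>s\<in>fst c0. \<exists>t\<in>T. snd c0 s - p0 \<in> W \<and> g = s \<otimes> t" if gN: "g \<in> N" for g
    proof -
      obtain z where g: "g \<in> fst c0" "snd c0 g = f z" and z: "z \<in> S"
        using gN interior_subset[of "f ` S"] by (auto simp: N_def)
      obtain s y where s: "s \<in> fst c0" "y \<in> fst c0" "s \<otimes> y \<in> fst c0"
        "u z = snd c0 s" "in_charts c c0 id (q z) = snd c0 y"
        using z by (auto simp: S_def mult_dom_def)
      obtain x where x: "x \<in> fst c" "x \<in> fst c0" "q z = snd c x"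
        using z by (auto simp: S_def S1_def O1_def)
      have "snd c0 x = snd c0 y"
        using s x by (simp add: in_charts_apply[OF c(1)])
      then have "x = y"
        using smooth_chart_inj[OF c0_smooth] s x by (meson inj_onD)
      have "snd c x \<in> W0"
        using x(3) p1 W0(1) JJ'(2) by (metis q_def subspace_add)
      then have "snd c x \<in> snd c ` (fst c \<inter> T)"
        using adapted x by blast
      then have "x \<in> T"
        using smooth_chart_inj[OF c(1)] x(1) by (auto simp: inj_on_def)
      have "snd c0 g = snd c0 (s \<otimes> y)"
        using s mult_in_apply[of c0 c0 s y c0] by (simp add: g(2) f_def)
      then have "g = s \<otimes> y"
        using smooth_chart_inj[OF c0_smooth] s g by (meson inj_onD)
      moreover have "snd c0 s - p0 \<in> W"
      proof -
        have "snd c0 s - p0 = z - \<pi> z"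
          using s(4) by (simp add: u_def algebra_simps)
        moreover have "\<pi> (\<pi> z) = \<pi> z"
          using \<pi>(2,3) by auto
        ultimately show ?thesis
          by (simp add: W_def linear_diff[OF \<pi>(1)])
      qed
      ultimately show ?thesis
        using s \<open>x \<in> T\<close> \<open>x = y\<close> by blast
    qed
  qed
qed

end

section \<open>The adjoint representation as a matrix\<close>

locale lie_group_basis = lie_group_charts G X A
  for G :: "'g monoid" (structure)
    and X :: "'g topology"
    and A :: "('g, real ^ 'n::{finite, linorder}) chart set" +
  fixes B :: "(('g, real ^ 'n::{finite, linorder}) chart \<Rightarrow> real ^ 'n::{finite, linorder}) \<Rightarrow>
              (('g, real ^ 'n::{finite, linorder}) chart \<Rightarrow> real ^ 'n::{finite, linorder}) \<Rightarrow> real"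
    and b :: "'n::{finite, linorder} \<Rightarrow> ('g, real ^ 'n::{finite, linorder}) chart \<Rightarrow> real ^ 'n::{finite, linorder}"
  assumes inner_product: "inner_product_on (lie_algebra G A) B"
    and invariant: "Ad_invariant G A B"
    and orthonormal: "orthonormal_basis_on (lie_algebra G A) B b"
begin

abbreviation "\<gg> \<equiv> tangent_space A \<one>"

abbreviation "Adm \<equiv> Ad_matrix G A B b"

section \<open>The inner product and orthogonality of the matrix\<close>

lemma B_commute: "u \<in> \<gg> \<Longrightarrow> v \<in> \<gg> \<Longrightarrow> B u v = B v u"
  using inner_product unfolding inner_product_on_def lie_algebra_def by blast

lemma B_lincomb:
  "u \<in> \<gg> \<Longrightarrow> v \<in> \<gg> \<Longrightarrow> w \<in> \<gg> \<Longrightarrow> B (\<lambda>c. s *\<^sub>R u c + t *\<^sub>R v c) w = s * B u w + t * B v w"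
  using inner_product unfolding inner_product_on_def lie_algebra_def by blast

lemma b_tangent: "b i \<in> \<gg>"
  using orthonormal unfolding orthonormal_basis_on_def lie_algebra_def by blast

lemma B_b: "B (b i) (b j) = (if i = j then 1 else 0)"
  using orthonormal unfolding orthonormal_basis_on_def by blast

lemma zero_tangent: "(\<lambda>_. 0) \<in> \<gg>"
  using tangent_space_lincomb[OF b_tangent b_tangent, of 0 undefined 0 undefined] by simp

lemma B_zero: "w \<in> \<gg> \<Longrightarrow> B (\<lambda>_. 0) w = 0"
  using B_lincomb[of w w w 0 0] by simp

text \<open>The two claims share one induction because \<open>B\<close> is known to be linear on
  tangent vectors only.\<close>

lemma sum_tangent_B:
  assumes "finite I"
  shows "(\<lambda>c. \<Sum>i\<in>I. s i *\<^sub>R b i c) \<in> \<gg> \<and>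
    (\<forall>w\<in>\<gg>. B (\<lambda>c. \<Sum>i\<in>I. s i *\<^sub>R b i c) w = (\<Sum>i\<in>I. s i * B (b i) w))"
  using assms
proof induction
  case empty
  show ?case by (simp add: zero_tangent B_zero)
next
  case (insert j I)
  let ?S = "\<lambda>c. \<Sum>i\<in>I. s i *\<^sub>R b i c"
  have eq: "(\<lambda>c. \<Sum>i\<in>insert j I. s i *\<^sub>R b i c) = (\<lambda>c. s j *\<^sub>R b j c + 1 *\<^sub>R ?S c)"
    using insert.hyps by simp
  show ?case
    unfolding eq using insert tangent_space_lincomb[OF b_tangent, of ?S "s j" j 1]
      B_lincomb[OF b_tangent, of ?S _ "s j" j 1] by simp
qed

lemma sum_tangent: "(\<lambda>c. \<Sum>i\<in>UNIV. s i *\<^sub>R b i c) \<in> \<gg>"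
  and B_sum: "w \<in> \<gg> \<Longrightarrow> B (\<lambda>c. \<Sum>i\<in>UNIV. s i *\<^sub>R b i c) w = (\<Sum>i\<in>UNIV. s i * B (b i) w)"
  using sum_tangent_B[of UNIV s] by auto

lemma expansion:
  assumes "v \<in> \<gg>"
  shows "v = (\<lambda>c. \<Sum>i\<in>UNIV. B (b i) v *\<^sub>R b i c)"
proof -
  obtain s where s: "v = (\<lambda>c. \<Sum>i\<in>UNIV. s i *\<^sub>R b i c)"
    using assms orthonormal unfolding orthonormal_basis_on_def lie_algebra_def by blast
  have "B (b k) v = s k" for k
    using B_commute[OF b_tangent assms] by (simp add: s B_sum[OF b_tangent] B_b if_distrib cong: if_cong)
  then show ?thesis using s by simp
qed

lemma Ad_b:
  assumes "g \<in> carrier G"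
  shows "Ad G A g (b j) = (\<lambda>c. \<Sum>i\<in>UNIV. Adm g $ i $ j *\<^sub>R b i c)"
  using expansion[OF Ad_tangent_space[OF assms]] by (simp add: Ad_matrix_def)

lemma Adm_orthogonal:
  assumes g: "g \<in> carrier G"
  shows "orthogonal_matrix (Adm g)"
proof -
  have "(\<Sum>k\<in>UNIV. Adm g $ k $ i * Adm g $ k $ j) = (if i = j then 1 else 0)" for i j
  proof -
    have "(\<Sum>k\<in>UNIV. Adm g $ k $ i * Adm g $ k $ j) = (\<Sum>k\<in>UNIV. Adm g $ k $ i * B (b k) (Ad G A g (b j)))"
      by (simp add: Ad_matrix_def)
    also have "\<dots> = B (Ad G A g (b i)) (Ad G A g (b j))"
      by (subst (2) Ad_b[OF g]) (simp add: B_sum[OF Ad_tangent_space[OF g]])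
    also have "\<dots> = B (b i) (b j)"
      using invariant g b_tangent unfolding Ad_invariant_def lie_algebra_def by blast
    finally show ?thesis by (simp add: B_b)
  qed
  then show ?thesis
    by (simp add: orthogonal_matrix matrix_matrix_mult_def transpose_def mat_def vec_eq_iff)
qed

text \<open>The change from coefficients in the basis \<open>b\<close> to coordinates in
  \<open>c0\<close>; it intertwines the matrix of \<open>Ad\<close> with \<open>Ad0\<close>.\<close>

definition tangent_of :: "real ^ 'n::{finite, linorder} \<Rightarrow> real ^ 'n::{finite, linorder}" where
  "tangent_of x = (\<Sum>i\<in>UNIV. x $ i *\<^sub>R b i c0)"

lemma tangent_of_linear: "linear tangent_of"
  unfolding tangent_of_def by (intro linearI) (simp_all add: algebra_simps sum.distrib scaleR_sum_right)

lemma tangent_of_inj: "inj tangent_of"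
  unfolding linear_injective_0[OF tangent_of_linear]
proof (intro allI impI)
  fix x assume "tangent_of x = 0"
  then have "(\<lambda>c. \<Sum>i\<in>UNIV. x $ i *\<^sub>R b i c) = (\<lambda>_. 0)"
    by (intro tangent_space_eqI sum_tangent zero_tangent) (simp add: tangent_of_def)
  then have "(\<Sum>i\<in>UNIV. x $ i * B (b i) (b k)) = 0" for k
    using B_sum[OF b_tangent, of "\<lambda>i. x $ i" k] B_zero[OF b_tangent] by simp
  then show "x = 0"
    by (simp add: B_b vec_eq_iff if_distrib cong: if_cong)
qed

definition coeffs :: "real ^ 'n::{finite, linorder} \<Rightarrow> real ^ 'n::{finite, linorder}" where
  "coeffs = inv_into UNIV tangent_of"

lemma coeffs_tangent_of [simp]: "coeffs (tangent_of x) = x"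
  by (simp add: coeffs_def tangent_of_inj)

lemma tangent_of_coeffs [simp]: "tangent_of (coeffs y) = y"
  using linear_injective_imp_surjective[OF tangent_of_linear tangent_of_inj] by (simp add: coeffs_def surj_f_inv_f)

lemma coeffs_linear: "linear coeffs"
proof (rule linearI)
  fix x y :: "real ^ 'n::{finite, linorder}" and s :: real
  show "coeffs (x + y) = coeffs x + coeffs y"
    by (metis tangent_of_coeffs coeffs_tangent_of linear_add[OF tangent_of_linear])
  show "coeffs (s *\<^sub>R x) = s *\<^sub>R coeffs x"
    by (metis tangent_of_coeffs coeffs_tangent_of linear_scale[OF tangent_of_linear])
qed

lemma Ad0_tangent_of:
  assumes g: "g \<in> carrier G"
  shows "Ad0 g (tangent_of x) = tangent_of (Adm g *v x)"
proof -
  have "Ad0 g (tangent_of x) = (\<Sum>j\<in>UNIV. x $ j *\<^sub>R Ad0 g (b j c0))"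
    unfolding tangent_of_def using Ad0_linear[OF g] by (simp add: linear_sum linear_scale)
  also have "\<dots> = (\<Sum>j\<in>UNIV. x $ j *\<^sub>R (\<Sum>i\<in>UNIV. Adm g $ i $ j *\<^sub>R b i c0))"
    using Ad_b[OF g] by (simp flip: Ad_c0[OF g])
  also have "\<dots> = (\<Sum>i\<in>UNIV. \<Sum>j\<in>UNIV. (Adm g $ i $ j * x $ j) *\<^sub>R b i c0)"
    by (subst sum.swap) (simp add: scaleR_sum_right mult.commute)
  also have "\<dots> = tangent_of (Adm g *v x)"
    by (simp add: tangent_of_def matrix_vector_mult_def scaleR_sum_left)
  finally show ?thesis .
qed

lemma Adm_apply: "g \<in> carrier G \<Longrightarrow> Adm g *v x = coeffs (Ad0 g (tangent_of x))"
  by (simp add: Ad0_tangent_of)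

lemma Adm_mult: "g \<in> carrier G \<Longrightarrow> h \<in> carrier G \<Longrightarrow> Adm (g \<otimes> h) *v x = Adm g *v (Adm h *v x)"
  by (simp add: Adm_apply Ad0_mult)

lemma Adm_one: "Adm \<one> = mat 1"
  by (simp add: matrix_eq Adm_apply Ad0_one)

lemma Adm_norm: "g \<in> carrier G \<Longrightarrow> norm (Adm g *v x) = norm x"
  by (simp add: norm_eq_sqrt_inner orthogonal_matrix_inner[OF Adm_orthogonal])

section \<open>Differentiability and continuity of the matrix\<close>

abbreviation "\<psi> c \<equiv> inv_into (fst c) (snd c)"

text \<open>Differentiating \<open>(g \<otimes> x \<otimes> inv g) \<otimes> g = g \<otimes> x\<close> at \<open>x = \<one>\<close> gives \<open>M (Ad g) = N\<close>, where \<open>M\<close> and \<open>N\<close> are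
  partial derivatives of the multiplication at \<open>(\<one>, g)\<close> and \<open>(g, \<one>)\<close>, and \<open>M\<close> is the identity at
  \<open>g = \<one>\<close>. As \<open>Ad g\<close> is bounded, this makes \<open>Ad\<close> continuous and then differentiable at \<open>\<one>\<close>.\<close>

lemma Adm_differentiable_one: "(\<lambda>y. Adm (\<psi> c0 y) *v x) differentiable (at p0)"
proof -
  let ?D = "frechet_derivative (mult_in c0 c0 c0)"
  let ?V = "snd c0 ` fst c0"
  define f where "f y = Adm (\<psi> c0 y) *v x" for y
  define M where "M y z = coeffs (?D (at (p0, y)) (tangent_of z, 0))" for y z
  define N where "N y = coeffs (?D (at (y, p0)) (0, tangent_of x))" for y
  define e where "e i y = (f y - x) $ i" for i y
  define h where "h i y = axis i 1 - M y (axis i 1)" for i y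
  have openV: "open ?V" by (rule smooth_chart_open[OF c0_smooth])
  have p0: "p0 \<in> ?V" by simp
  have evV: "\<forall>\<^sub>F y in at p0. y \<in> ?V"
    using openV p0 by (rule eventually_at_in_open')
  have key: "M y (f y) = N y" and lin: "linear (M y)" if y: "y \<in> ?V" for y
  proof -
    obtain g where g: "g \<in> fst c0" "y = snd c0 g" using y by blast
    have gG: "g \<in> carrier G" using chart_carrier[OF c0_smooth g(1)] .
    have f: "f y = Adm g *v x"
      using smooth_chart_inv[OF c0_smooth g(1)] g(2) by (simp add: f_def)
    have left: "(in_charts c0 c0 ((\<otimes>) g) has_derivative (\<lambda>v. ?D (at (y, p0)) (0, v))) (at p0)"
      using mult_left_has_derivative[of c0 c0 c0 g \<one>] g gG by simp
    have right: "(in_charts c0 c0 (\<lambda>x. x \<otimes> g) has_derivative (\<lambda>v. ?D (at (p0, y)) (v, 0))) (at p0)"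
      using mult_right_has_derivative[of c0 c0 c0 \<one> g] g gG by simp
    have "(in_charts c0 c0 ((\<otimes>) g) has_derivative (\<lambda>v. ?D (at (p0, y)) (v, 0)) \<circ> Ad0 g) (at p0)"
    proof (rule in_charts_chain[OF c0_smooth c0_smooth, where F = "conjugation g" and H = "\<lambda>x. x \<otimes> g"])
      show "g \<otimes> z = conjugation g z \<otimes> g" if "z \<in> fst c0" for z
        using gG chart_carrier[OF c0_smooth that] by (simp add: m_assoc)
    qed (use gG right Ad0_has_derivative conjugation_continuous in auto)
    then have "?D (at (p0, y)) (Ad0 g v, 0) = ?D (at (y, p0)) (0, v)" for v
      using fun_cong[OF has_derivative_unique[OF left], of _ v] by simp
    then show "M y (f y) = N y"
      by (simp add: M_def N_def f Ad0_tangent_of[OF gG, symmetric])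
    show "linear (M y)"
      unfolding M_def
      using linear_compose[OF linear_compose[OF tangent_of_linear has_derivative_linear[OF right]] coeffs_linear]
      by (simp add: comp_def)
  qed
  have M_p0: "M p0 z = z" for z
    by (simp add: M_def mult_in_derivative_one)
  have f_p0: "f p0 = x"
    using smooth_chart_inv[OF c0_smooth one_c0] by (simp add: f_def Adm_one)
  have N_p0: "N p0 = x"
    by (simp add: N_def mult_in_derivative_one)
  have dom: "(p0, p0) \<in> mult_dom c0 c0 c0"
    by (auto simp: mult_dom_def intro!: exI[of _ \<one>])
  have D2: "(\<lambda>z. ?D (at z) w) differentiable (at (p0, p0))" for w
    using smooth_on_differentiable2[OF mult_in_smooth[of c0 c0 c0] dom] by simp
  have lin_diff: "coeffs differentiable (at z)" for z
    using coeffs_linear by (rule linear_imp_differentiable)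
  have M_diff: "(\<lambda>y. M y z) differentiable (at p0)" for z
  proof -
    have "((\<lambda>y. (p0, y)) has_derivative (\<lambda>v. (0, v))) (at p0)"
      by (intro derivative_intros)
    then have "(\<lambda>y. (p0, y)) differentiable (at p0)"
      by (rule differentiableI)
    from differentiable_chain_at[OF differentiable_chain_at[OF this D2] lin_diff]
    show ?thesis by (simp add: comp_def M_def)
  qed
  have N_diff: "N differentiable (at p0)"
  proof -
    have "((\<lambda>y. (y, p0)) has_derivative (\<lambda>v. (v, 0))) (at p0)"
      by (intro derivative_intros)
    then have "(\<lambda>y. (y, p0)) differentiable (at p0)"
      by (rule differentiableI)
    from differentiable_chain_at[OF differentiable_chain_at[OF this D2] lin_diff]
    show ?thesis by (simp add: comp_def N_def[abs_def])
  qed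
  have h_diff: "h i differentiable (at p0)" for i
    unfolding h_def by (intro differentiable_diff M_diff differentiable_const)
  have h_p0: "h i p0 = 0" for i
    by (simp add: h_def M_p0)
  \<comment> \<open>This is M y (f y) = N y solved for f y up to the error (1 - M y) (f y - x). In
    the error each \<open>h i\<close> is differentiable and vanishes at \<open>p0\<close>, while the
    unknown \<open>f\<close> enters only through the scalars \<open>e i\<close>.\<close>
  have decomp: "f y = x + (N y - M y x) + (\<Sum>i\<in>UNIV. e i y *\<^sub>R h i y)" if y: "y \<in> ?V" for y
  proof -
    have sum: "f y - x = (\<Sum>i\<in>UNIV. e i y *\<^sub>R axis i 1)"
      using basis_expansion[of "f y - x"] by (simp add: e_def scalar_mult_eq_scaleR)
    have "M y (f y - x) = (\<Sum>i\<in>UNIV. e i y *\<^sub>R M y (axis i 1))"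
      unfolding sum using lin[OF y] by (simp add: linear_sum linear_scale)
    then have "(f y - x) - M y (f y - x) = (\<Sum>i\<in>UNIV. e i y *\<^sub>R h i y)"
      by (subst sum) (simp add: h_def scaleR_diff_right sum_subtractf)
    moreover have "M y (f y - x) = N y - M y x"
      using key[OF y] linear_diff[OF lin[OF y]] by simp
    ultimately show ?thesis by (simp add: algebra_simps)
  qed
  have e_le: "\<bar>e i y\<bar> \<le> 2 * norm x" if "y \<in> ?V" for i y
  proof -
    have "\<psi> c0 y \<in> carrier G"
      using that by (intro chart_carrier[OF c0_smooth] inv_into_into)
    then have "norm (f y) = norm x" by (simp add: f_def Adm_norm)
    then show ?thesis
      using component_le_norm_cart[of "f y - x" i] norm_triangle_ineq4[of "f y" x] by (simp add: e_def)
  qed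
  have e_bound: "\<forall>\<^sub>F y in at p0. \<bar>e i y\<bar> \<le> 2 * norm x" for i
    by (rule eventually_mono[OF evV e_le])
  have tendsto: "(F \<longlongrightarrow> F p0) (at p0)" if "F differentiable (at p0)"
    for F :: "real ^ 'n::{finite, linorder} \<Rightarrow> real ^ 'n::{finite, linorder}"
    using differentiable_imp_continuous_within[OF that] by (simp add: continuous_within)
  \<comment> \<open>First pass: the scalars are bounded and the vectors \<open>h i\<close> tend to
    0, which gives the limit of \<open>f\<close>.\<close>
  have "((\<lambda>y. x + (N y - M y x) + (\<Sum>i\<in>UNIV. e i y *\<^sub>R h i y)) \<longlongrightarrow>
      x + (x - x) + (\<Sum>i\<in>(UNIV :: 'n::{finite, linorder} set). 0)) (at p0)"
    using tendsto[OF N_diff] tendsto[OF M_diff] tendsto[OF h_diff]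
    by (intro tendsto_intros tendsto_zero_bounded_scaleR[OF _ e_bound]) (simp_all add: N_p0 M_p0 h_p0)
  moreover have "\<forall>\<^sub>F y in at p0. x + (N y - M y x) + (\<Sum>i\<in>UNIV. e i y *\<^sub>R h i y) = f y"
    by (rule eventually_mono[OF evV]) (rule decomp[symmetric])
  ultimately have "(f \<longlongrightarrow> x + (x - x) + (\<Sum>i\<in>(UNIV :: 'n::{finite, linorder} set). 0)) (at p0)"
    by (rule Lim_transform_eventually)
  then have "(f \<longlongrightarrow> x) (at p0)"
    by simp
  then have "((\<lambda>y. f y - x) \<longlongrightarrow> 0) (at p0)"
    by (simp add: LIM_zero)
  then have e_0: "(e i \<longlongrightarrow> 0) (at p0)" for i
    unfolding e_def using tendsto_vec_nth by fastforce
  \<comment> \<open>Second pass: with the limit known, the scalars tend to 0 and the error has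
    derivative 0.\<close>
  have "((\<lambda>y. e i y *\<^sub>R h i y) has_derivative (\<lambda>_. 0)) (at p0)" for i
    using h_diff[of i] tendsto_zero_scaleR_has_derivative[of "h i" _ p0 "e i"] h_p0 e_0
    unfolding differentiable_def by blast
  then have "(\<lambda>y. e i y *\<^sub>R h i y) differentiable (at p0)" for i
    unfolding differentiable_def by blast
  then have "(\<lambda>y. x + (N y - M y x) + (\<Sum>i\<in>UNIV. e i y *\<^sub>R h i y)) differentiable (at p0)"
    by (intro differentiable_add differentiable_diff differentiable_sum differentiable_const N_diff M_diff) auto
  then obtain F' where "((\<lambda>y. x + (N y - M y x) + (\<Sum>i\<in>UNIV. e i y *\<^sub>R h i y)) has_derivative F') (at p0)"
    unfolding differentiable_def by blast
  from has_derivative_transform_within_open[OF this openV p0 decomp[symmetric]]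
  have "f differentiable (at p0)"
    by (rule differentiableI)
  then show ?thesis by (simp add: f_def[abs_def])
qed

text \<open>Translation by \<open>inv g\<close> carries \<open>g\<close> to \<one>, and Ad z = Ad g
  Ad (inv g z). This reduces every point to the identity.\<close>

lemma Adm_differentiable:
  assumes c: "c \<in> A" and y: "y \<in> snd c ` fst c"
  shows "(\<lambda>y. Adm (\<psi> c y) *v x) differentiable (at y)"
proof -
  obtain g where g: "g \<in> fst c" "y = snd c g" using y by blast
  have gG: "g \<in> carrier G" using chart_carrier[OF atlas[OF c] g(1)] .
  define h where "h = inv g"
  have h: "h \<in> carrier G" "h \<otimes> g = \<one>" using gG by (auto simp: h_def)
  obtain d where d: "d \<in> A" "h \<in> fst d" using chart_exists[OF h(1)] by blast
  define \<mu> where "\<mu> = in_charts c c0 ((\<otimes>) h)"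
  have \<mu>: "\<mu> differentiable (at y)" "\<mu> y = p0"
    using mult_left_has_derivative[OF d(1) c c0_A d(2) g(1)] h
    by (auto simp: \<mu>_def g(2) differentiable_def in_charts_apply[OF atlas[OF c] g(1)])
  let ?F = "\<lambda>y. Adm g *v (Adm (\<psi> c0 (\<mu> y)) *v x)"
  have "(\<lambda>v. Adm g *v v) differentiable (at z)" for z
    by (intro linear_imp_differentiable matrix_vector_mul_linear)
  from differentiable_chain_at[OF differentiable_chain_at[OF \<mu>(1), of "\<lambda>y. Adm (\<psi> c0 y) *v x"] this]
  have "?F differentiable (at y)"
    using Adm_differentiable_one by (simp add: \<mu>(2) comp_def)
  then obtain F' where F': "(?F has_derivative F') (at y)"
    unfolding differentiable_def by blast
  have "((\<lambda>y. Adm (\<psi> c y) *v x) has_derivative F') (at y)"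
  proof (rule has_derivative_transform_within_open[OF F'])
    let ?U = "{z \<in> topspace X. h \<otimes> z \<in> fst c0}"
    have "openin X ?U"
      using mult_left_continuous[OF h(1)] smooth_chart_openin[OF c0_smooth]
      by (rule openin_continuous_map_preimage)
    then show "open (snd c ` (fst c \<inter> ?U))"
      by (rule smooth_chart_image_open[OF atlas[OF c]])
    show "y \<in> snd c ` (fst c \<inter> ?U)"
      using g h gG by auto
    fix y' assume "y' \<in> snd c ` (fst c \<inter> ?U)"
    then obtain z where z: "z \<in> fst c" "z \<in> carrier G" "h \<otimes> z \<in> fst c0" "y' = snd c z"
      by auto
    have "\<psi> c0 (\<mu> y') = h \<otimes> z"
      using z by (simp add: \<mu>_def in_charts_apply[OF atlas[OF c]] smooth_chart_inv[OF c0_smooth])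
    moreover have "\<psi> c y' = g \<otimes> (h \<otimes> z)"
      using z gG by (simp add: smooth_chart_inv[OF atlas[OF c]] h_def flip: m_assoc)
    ultimately show "?F y' = Adm (\<psi> c y') *v x"
      using gG h z by (simp add: Adm_mult)
  qed
  then show ?thesis
    unfolding differentiable_def by blast
qed

lemma Adm_continuous: "continuous_map X euclidean Adm"
proof (rule pasting_lemma[where I = A and T = fst and f = "\<lambda>_. Adm"])
  show "openin X (fst c)" if "c \<in> A" for c
    using smooth_chart_openin[OF atlas[OF that]] .
  show "continuous_map (subtopology X (fst c)) euclidean Adm" if c: "c \<in> A" for c
  proof -
    have "continuous_on (snd c ` fst c) (\<lambda>y. Adm (\<psi> c y) *v x)" for x
      using Adm_differentiable[OF c]
      by (intro differentiable_imp_continuous_on differentiable_at_imp_differentiable_on)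
    then have "continuous_on (snd c ` fst c) (\<lambda>y. \<chi> i j. (Adm (\<psi> c y) *v axis j 1) $ i)"
      by (intro continuous_on_vec_lambda continuous_on_component)
    then have "continuous_on (snd c ` fst c) (\<lambda>y. Adm (\<psi> c y))"
      by (simp add: matrix_vector_mult_basis column_def)
    moreover have "continuous_map (subtopology X (fst c)) (top_of_set (snd c ` fst c)) (snd c)"
      using smooth_chart_continuous[OF atlas[OF c]] by (auto simp: continuous_map_in_subtopology)
    ultimately have "continuous_map (subtopology X (fst c)) euclidean ((\<lambda>y. Adm (\<psi> c y)) \<circ> snd c)"
      by (intro continuous_map_compose) auto
    then show ?thesis
      by (rule continuous_map_eq) (auto simp: smooth_chart_inv[OF atlas[OF c]])
  qed
  show "\<exists>c. c \<in> A \<and> x \<in> fst c \<and> Adm x = Adm x" if "x \<in> topspace X" for x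
    using chart_exists[of x] that unfolding top by blast
qed simp

lemma Adm_SO:
  assumes "connected_space X"
  shows "continuous_map X (top_of_set SO) Adm"
proof -
  have "Adm x \<in> SO" if "x \<in> topspace X" for x
    using that by (intro SO_if_connected[OF assms Adm_continuous _ _ _ that, of \<one>])
      (simp_all add: Adm_orthogonal Adm_one)
  then show ?thesis
    using Adm_continuous by (simp add: continuous_map_in_subtopology image_subset_iff)
qed

section \<open>Compression along a torus\<close>

lemma homotopic_into_standard_SO_if_torus:
  assumes "compact_space X" "connected_space X" and T: "torus_in G X A r T" and "q < r"
  shows "homotopic_into_standard_SO X (CARD('n) - q) Adm"
proof -
  obtain V0 W N where V0: "subspace V0" "dim V0 = r" and W: "subspace W" "dim W + r \<le> DIM(real ^ 'n::{finite, linorder})"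
    and N: "openin X N" "\<one> \<in> N"
    and fixes_V0: "\<And>t v. t \<in> T \<Longrightarrow> v \<in> V0 \<Longrightarrow> Ad0 t v = v"
    and slice: "\<And>g. g \<in> N \<Longrightarrow> \<exists>s\<in>fst c0. \<exists>t\<in>T. snd c0 s - p0 \<in> W \<and> g = s \<otimes> t"
    using torus_slice[OF T] by metis
  have TG: "T \<subseteq> carrier G"
    using T subgroup.subset unfolding torus_in_def by blast
  \<comment> \<open>The translate of \<open>N\<close> by \<open>g\<close>; by compactness finitely
    many of them cover the group, and their base points index the pieces.\<close>
  define NN where "NN g = {z \<in> topspace X. inv g \<otimes> z \<in> N}" for g
  have "openin X (NN g)" if "g \<in> carrier G" for g
    unfolding NN_def using mult_left_continuous[of "inv g"] that N(1)
    by (intro openin_continuous_map_preimage) auto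
  moreover have "topspace X \<subseteq> \<Union> (NN ` carrier G)"
    using N by (auto simp: NN_def)
  ultimately obtain \<F> where \<F>: "finite \<F>" "\<F> \<subseteq> NN ` carrier G" "topspace X \<subseteq> \<Union>\<F>"
    using assms(1) unfolding compact_space_alt by (metis (no_types, lifting) imageE)
  then obtain J where J: "finite J" "J \<subseteq> carrier G" "\<F> = NN ` J"
    by (meson finite_subset_image)
  define D where "D = {w \<in> W. p0 + w \<in> snd c0 ` fst c0}"
  define \<sigma> where "\<sigma> g w = g \<otimes> \<psi> c0 (p0 + w)" for g w
  define V where "V = coeffs ` V0"
  have in_G: "\<psi> c0 (p0 + w) \<in> carrier G" if "w \<in> D" for w
    using that by (intro chart_carrier[OF c0_smooth] inv_into_into) (simp add: D_def)
  have "inj coeffs" by (metis tangent_of_coeffs injI)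
  then have "dim V = r"
    unfolding V_def using V0 coeffs_linear by (metis dim_image_eq inj_on_subset subset_UNIV span_eq_iff)
  have cover: "\<exists>j\<in>J. \<exists>w\<in>D. \<forall>v\<in>V. Adm x *v v = Adm (\<sigma> j w) *v v" if x: "x \<in> topspace X" for x
  proof -
    obtain g where g: "g \<in> J" "inv g \<otimes> x \<in> N"
      using x \<F>(3) J(3) by (auto simp: NN_def)
    have gG: "g \<in> carrier G" and xG: "x \<in> carrier G" using g J(2) x by auto
    obtain s t where st: "s \<in> fst c0" "t \<in> T" "snd c0 s - p0 \<in> W" "inv g \<otimes> x = s \<otimes> t"
      using slice[OF g(2)] by blast
    have stG: "s \<in> carrier G" "t \<in> carrier G"
      using st TG chart_carrier[OF c0_smooth] by auto
    have "x = g \<otimes> (inv g \<otimes> x)" using gG xG by (simp flip: m_assoc)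
    then have x_eq: "x = (g \<otimes> s) \<otimes> t" using gG stG by (simp add: st(4) m_assoc)
    have w: "snd c0 s - p0 \<in> D" using st by (auto simp: D_def)
    have "\<sigma> g (snd c0 s - p0) = g \<otimes> s"
      using smooth_chart_inv[OF c0_smooth st(1)] by (simp add: \<sigma>_def)
    \<comment> \<open>The factor from the torus disappears on \<open>V\<close>, so only the position
      \<open>s\<close> in the slice matters.\<close>
    moreover have "Adm t *v v = v" if "v \<in> V" for v
      using that stG fixes_V0[OF st(2)] by (auto simp: V_def Adm_apply)
    ultimately have "\<forall>v\<in>V. Adm x *v v = Adm (\<sigma> g (snd c0 s - p0)) *v v"
      using gG stG by (simp add: x_eq Adm_mult)
    then show ?thesis using g(1) w by blast
  qed
  have diff: "(\<lambda>w. Adm (\<sigma> j w) *v v) differentiable_on D" if j: "j \<in> J" for j v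
    unfolding differentiable_on_def
  proof
    fix w assume w: "w \<in> D"
    have "(\<lambda>w. p0 + w) differentiable (at w)"
      by (intro differentiable_add differentiable_const differentiable_ident)
    moreover have "(\<lambda>y. Adm (\<psi> c0 y) *v v) differentiable (at (p0 + w))"
      using w by (intro Adm_differentiable c0_A) (simp add: D_def)
    ultimately have "(\<lambda>w. Adm (\<psi> c0 (p0 + w)) *v v) differentiable (at w)"
      using differentiable_chain_at by (fastforce simp: comp_def)
    moreover have "(\<lambda>v. Adm j *v v) differentiable (at z)" for z
      by (intro linear_imp_differentiable matrix_vector_mul_linear)
    ultimately have "((\<lambda>v. Adm j *v v) \<circ> (\<lambda>w. Adm (\<psi> c0 (p0 + w)) *v v)) differentiable (at w)"
      by (rule differentiable_chain_at)
    then have "(\<lambda>w. Adm j *v (Adm (\<psi> c0 (p0 + w)) *v v)) differentiable (at w within D)"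
      by (simp add: comp_def differentiable_at_withinI)
    moreover have "Adm j *v (Adm (\<psi> c0 (p0 + w')) *v v) = Adm (\<sigma> j w') *v v" if "w' \<in> D" for w'
      using j J(2) in_G[OF that] by (auto simp: \<sigma>_def Adm_mult)
    ultimately show "(\<lambda>w. Adm (\<sigma> j w) *v v) differentiable (at w within D)"
      \<comment> \<open>The identity holds on all of \<open>D\<close>, so the radius 1 is arbitrary.
        It is applied within \<open>D\<close> because \<open>D\<close> lies in \<open>W\<close> and
        is in general not open.\<close>
      by (rule differentiable_transform_within[OF _ zero_less_one w])
  qed
  show ?thesis
  proof (rule homotopic_into_standard_SO_if_pieces[OF Adm_SO[OF assms(2)] J(1) W(1) _ _ _ cover diff])
    show "D \<subseteq> W" by (auto simp: D_def)
    show "subspace V"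
      unfolding V_def using V0 coeffs_linear by (simp add: linear_subspace_image)
    show "\<sigma> j w \<in> topspace X" if "j \<in> J" "w \<in> D" for j w
      using that J(2) in_G by (auto simp: \<sigma>_def)
    show "dim W + dim V \<le> CARD('n)" "q < dim V"
      using W(2) \<open>dim V = r\<close> \<open>q < r\<close> by simp_all
  qed
qed

end

theorem theorem3p1:
  fixes G :: "'g monoid"
    and X :: "'g topology"
    and A :: "('g, real ^ 'n::{finite, linorder}) chart set"
    and B :: "(('g, real ^ 'n::{finite, linorder}) chart \<Rightarrow> real ^ 'n::{finite, linorder}) \<Rightarrow>
              (('g, real ^ 'n::{finite, linorder}) chart \<Rightarrow> real ^ 'n::{finite, linorder}) \<Rightarrow> real"
    and b :: "'n::{finite, linorder} \<Rightarrow> ('g, real ^ 'n::{finite, linorder}) chart \<Rightarrow> real ^ 'n::{finite, linorder}"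
    and r :: nat
  assumes "lie_group G X A"
    and "compact_space X"
    and "connected_space X"
    and "lie_rank G X A r"
    and "inner_product_on (lie_algebra G A) B"
    and "Ad_invariant G A B"
    and "orthonormal_basis_on (lie_algebra G A) B b"
  shows "homotopic_into_standard_SO X (CARD('n) - r + 1) (Ad_matrix G A B b)
       \<and> compressible (r - 1) X (Ad_matrix G A B b)"
proof -
  have "group G" using assms(1) by (simp add: lie_group_def)
  then interpret lie_group_basis G X A B b
    using assms by (intro lie_group_basis.intro lie_group_charts.intro lie_group_charts_axioms.intro
        lie_group_basis_axioms.intro)
  obtain T where T: "torus_in G X A r T"
    using assms(4) by (auto simp: lie_rank_def maximal_torus_def)
  note SO = Adm_SO[OF assms(3)]
  show ?thesis
  proof (cases "r = 0")
    case True
    \<comment> \<open>For rank 0 the two target dimensions are \<open>CARD('n) + 1\<close> and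
      \<open>CARD('n)\<close>. In both cases no basis vector has to be fixed, and \<open>Adm\<close>
      itself is the terminal map.\<close>
    have "homotopic_into_standard_SO X m Adm" if "CARD('n) \<le> m" for m
      unfolding homotopic_into_standard_SO_def
      using SO that by (intro exI[of _ Adm]) (auto simp: standard_SO_def continuous_map_in_subtopology)
    then show ?thesis
      using True by (simp add: compressible_def)
  next
    case False
    then have "r - 1 < r" by simp
    from homotopic_into_standard_SO_if_torus[OF assms(2,3) T this]
    have "homotopic_into_standard_SO X (CARD('n) - (r - 1)) Adm" .
    \<comment> \<open>The dimension bound of the slice yields \<open>r \<le> CARD('n)\<close>; this
      reconciles the two forms of the target dimension under truncated subtraction.\<close>
    moreover obtain W :: "(real ^ 'n::{finite, linorder}) set" where "dim W + r \<le> DIM(real ^ 'n::{finite, linorder})"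
      using torus_slice[OF T] by blast
    then have "CARD('n) - (r - 1) = CARD('n) - r + 1"
      using False by simp
    ultimately show ?thesis
      by (metis compressible_def)
  qed
qed

end
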